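(* Let $\mathcal{H}$ be a separable Hilbert space and let $d\in\mathbb{N}$, $d\ge 1$. The space of contractive $C_0$-semigroups over $\mathcal{H}$ on the additive monoid $\mathbb{R}_+^d=[0,\infty)^d$ (one-parameter semigroups for $d=1$, multiparameter semigroups for $d\geq 2$), viewed under the topology of uniform weak operator convergence on compact subsets of $\mathbb{R}_+^d$, is Polish (i.e. separable and completely metrisable).
   Context: Hilbert spaces are complex. A contractive $C_0$-semigroup over $\mathcal{H}$ on $\mathbb{R}_+^d$ is a function $T$ from $\mathbb{R}_+^d$ to the bounded linear operators on $\mathcal{H}$, continuous with respect to the strong operator topology, with $\|T(t)\|\le 1$ for all $t$, $T(0)=\mathbf{I}$ and $T(s+t)=T(s)T(t)$ for all $s,t\in\mathbb{R}_+^d$, where $\mathbb{R}_+^d$ carries pointwise addition and its usual topology. The topology of uniform weak operator convergence on compact subsets is determined by the convergence condition for nets: $T_i\to T$ iff for all $\xi,\eta\in\mathcal{H}$ and all compact $K\subseteq \mathbb{R}_+^d$, $\sup_{t\in K}|\langle (T_i(t)-T(t))\xi,\eta\rangle|\to 0$. *)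

theory Defs
  imports "HOL-Analysis.Analysis"
begin

text \<open>Complex Hilbert spaces, with the inner product linear in its first argument.\<close>

class scaleC = scaleR +
  fixes scaleC :: "complex \<Rightarrow> 'a \<Rightarrow> 'a"  (infixr "*\<^sub>C" 75)
  assumes scaleR_scaleC: "scaleR r x = complex_of_real r *\<^sub>C x"

class complex_vector = scaleC + ab_group_add +
  assumes scaleC_add_right: "a *\<^sub>C (x + y) = a *\<^sub>C x + a *\<^sub>C y"
    and scaleC_add_left: "(a + b) *\<^sub>C x = a *\<^sub>C x + b *\<^sub>C x"
    and scaleC_scaleC: "a *\<^sub>C (b *\<^sub>C x) = (a * b) *\<^sub>C x"
    and scaleC_one: "1 *\<^sub>C x = x"

class complex_inner = complex_vector + real_normed_vector +
  fixes cinner :: "'a \<Rightarrow> 'a \<Rightarrow> complex"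
  assumes cinner_commute: "cinner x y = cnj (cinner y x)"
    and cinner_add_left: "cinner (x + y) z = cinner x z + cinner y z"
    and cinner_scaleC_left: "cinner (a *\<^sub>C x) y = a * cinner x y"
    and norm_sq_cinner: "cinner x x = complex_of_real ((norm x)\<^sup>2)"

class complex_hilbert_space = complex_inner + complete_space

definition orthant :: "(real ^ 'd) set"
  where "orthant = {t. \<forall>i. 0 \<le> t $ i}"

text \<open>
  The type \<open>'h \<Rightarrow>\<^sub>L 'h\<close> consists of the bounded real-linear operators, so complex homogeneity is
  required separately; the norm is the operator norm over either field. Semigroups are
  functions on the orthant, hence extensional when regarded as functions on \<open>real ^ 'd\<close>.
\<close>

definition contractive_semigroups :: "(real ^ 'd \<Rightarrow> ('h::complex_inner \<Rightarrow>\<^sub>L 'h)) set"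
  where "contractive_semigroups =
    {T \<in> extensional orthant.
       (\<forall>t\<in>orthant. \<forall>c x. blinfun_apply (T t) (c *\<^sub>C x) = c *\<^sub>C blinfun_apply (T t) x) \<and>
       continuous_map (top_of_set orthant) strong_operator_topology T \<and>
       (\<forall>t\<in>orthant. norm (T t) \<le> 1) \<and>
       T 0 = id_blinfun \<and>
       (\<forall>s\<in>orthant. \<forall>t\<in>orthant. T (s + t) = T s o\<^sub>L T t)}"

definition weak_dist ::
    "(real ^ 'd) set \<Rightarrow> 'h \<Rightarrow> 'h \<Rightarrow> (real ^ 'd \<Rightarrow> ('h::complex_inner \<Rightarrow>\<^sub>L 'h)) \<Rightarrow>
     (real ^ 'd \<Rightarrow> ('h \<Rightarrow>\<^sub>L 'h)) \<Rightarrow> real"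
  where "weak_dist K x y S T = (SUP t\<in>K. cmod (cinner ((S t - T t) x) y))"

text \<open>
  The topology of uniform weak operator convergence on compact subsets, given by the subbasis
  of balls of the pseudometrics \<open>weak_dist K x y\<close>. The empty compact set is excluded because
  the supremum of the empty set of reals is unspecified.
  That this topology has the intended convergent nets is \<open>limitin_semigroup_topology\<close> below.
\<close>

definition semigroup_topology :: "(real ^ 'd \<Rightarrow> ('h::complex_inner \<Rightarrow>\<^sub>L 'h)) topology"
  where "semigroup_topology = topology_generated_by
    {{T \<in> contractive_semigroups. weak_dist K x y T S < e} | K x y S e.
       compact K \<and> K \<subseteq> orthant \<and> K \<noteq> {} \<and> S \<in> contractive_semigroups \<and> 0 < e}"

lemma cinner_minus_left: "cinner (- x) y = - cinner (x::'h::complex_inner) y"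
  by (metis add.right_inverse add_eq_0_iff cinner_add_left add_cancel_right_left)

lemma cinner_diff_left: "cinner (x - z) y = cinner (x::'h::complex_inner) y - cinner z y"
  using cinner_add_left[of x "- z" y] by (simp add: cinner_minus_left)

lemma cinner_zero_left: "cinner (0::'h::complex_inner) y = 0"
  using cinner_diff_left[of 0 0 y] by simp

lemma norm_scaleC: "norm (c *\<^sub>C (x::'h::complex_inner)) = cmod c * norm x"
proof -
  have "cinner (c *\<^sub>C x) (c *\<^sub>C x) = c * cnj (cinner (c *\<^sub>C x) x)"
    using cinner_commute[of x "c *\<^sub>C x"] by (simp add: cinner_scaleC_left)
  also have "\<dots> = c * cnj c * cinner x x"
    by (simp add: cinner_scaleC_left norm_sq_cinner)
  finally have "complex_of_real ((norm (c *\<^sub>C x))\<^sup>2) = complex_of_real ((cmod c * norm x)\<^sup>2)"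
    by (simp add: norm_sq_cinner complex_norm_square[symmetric] power_mult_distrib)
  then have "(norm (c *\<^sub>C x))\<^sup>2 = (cmod c * norm x)\<^sup>2"
    using of_real_eq_iff by blast
  then show ?thesis
    by (simp add: power2_eq_iff_nonneg)
qed

lemma cinner_Cauchy_Schwarz: "cmod (cinner x y) \<le> norm (x::'h::complex_inner) * norm y"
proof (cases "y = 0")
  case True
  then show ?thesis
    using cinner_commute[of x y] by (simp add: cinner_zero_left)
next
  case False
  define n where "n = (norm y)\<^sup>2"
  have n: "n > 0" using False by (simp add: n_def)
  define c where "c = cinner x y"
  define u where "u = complex_of_real n *\<^sub>C x - c *\<^sub>C y"
  have uy: "cinner u y = 0"
    by (simp add: u_def cinner_diff_left cinner_scaleC_left norm_sq_cinner n_def c_def)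
  have ux: "cinner u x = complex_of_real (n * (norm x)\<^sup>2 - (cmod c)\<^sup>2)"
    using complex_norm_square[of c] cinner_commute[of y x]
    by (simp add: u_def cinner_diff_left cinner_scaleC_left norm_sq_cinner c_def)
  have "cinner u u = complex_of_real n * cnj (cinner u x) - c * cnj (cinner u y)"
    using cinner_commute[of x u] cinner_commute[of y u]
    by (metis cinner_diff_left cinner_scaleC_left u_def)
  then have "complex_of_real ((norm u)\<^sup>2) = complex_of_real (n * (n * (norm x)\<^sup>2 - (cmod c)\<^sup>2))"
    by (simp add: uy ux norm_sq_cinner)
  then have "(norm u)\<^sup>2 = n * (n * (norm x)\<^sup>2 - (cmod c)\<^sup>2)"
    using of_real_eq_iff by blast
  then have "0 \<le> n * (n * (norm x)\<^sup>2 - (cmod c)\<^sup>2)"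
    by (metis zero_le_power2)
  then have "(cmod c)\<^sup>2 \<le> (norm x * norm y)\<^sup>2"
    using n by (simp add: zero_le_mult_iff n_def power_mult_distrib mult.commute)
  then show ?thesis
    unfolding c_def by (rule power2_le_imp_le) simp
qed

lemma weak_dist_bound:
  fixes S T :: "real ^ 'd \<Rightarrow> ('h::complex_inner \<Rightarrow>\<^sub>L 'h)"
  assumes "S \<in> contractive_semigroups" "T \<in> contractive_semigroups" "t \<in> orthant"
  shows "cmod (cinner ((S t - T t) x) y) \<le> 2 * norm x * norm y"
proof -
  have "norm (S t) \<le> 1" "norm (T t) \<le> 1"
    using assms by (auto simp: contractive_semigroups_def)
  then have "norm (S t - T t) \<le> 2"
    using norm_triangle_ineq4[of "S t" "T t"] by linarith
  then have "norm ((S t - T t) x) \<le> 2 * norm x"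
    by (meson norm_blinfun order_trans mult_right_mono norm_ge_zero)
  then show ?thesis
    by (meson cinner_Cauchy_Schwarz order_trans mult_right_mono norm_ge_zero)
qed

lemma weak_dist_bdd:
  assumes "S \<in> contractive_semigroups" "T \<in> contractive_semigroups" "K \<subseteq> orthant"
  shows "bdd_above ((\<lambda>t. cmod (cinner ((S t - T t) x) y)) ` K)"
  using assms by (intro bdd_aboveI2[where M="2 * norm x * norm y"] weak_dist_bound) auto

lemma weak_dist_triangle:
  assumes "R \<in> contractive_semigroups" "S \<in> contractive_semigroups"
    "T \<in> contractive_semigroups" "K \<subseteq> orthant" "K \<noteq> {}"
  shows "weak_dist K x y R T \<le> weak_dist K x y R S + weak_dist K x y S T"
  unfolding weak_dist_def
proof (rule cSUP_least[OF assms(5)])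
  fix t assume t: "t \<in> K"
  have "cinner ((R t - T t) x) y = cinner ((R t - S t) x) y + cinner ((S t - T t) x) y"
    by (simp add: minus_blinfun.rep_eq cinner_diff_left)
  then have "cmod (cinner ((R t - T t) x) y) \<le>
      cmod (cinner ((R t - S t) x) y) + cmod (cinner ((S t - T t) x) y)"
    by (simp add: norm_triangle_ineq)
  also have "\<dots> \<le> (SUP t\<in>K. cmod (cinner ((R t - S t) x) y)) + (SUP t\<in>K. cmod (cinner ((S t - T t) x) y))"
    using assms t by (intro add_mono cSUP_upper weak_dist_bdd)
  finally show "cmod (cinner ((R t - T t) x) y) \<le> \<dots>" .
qed

lemma weak_dist_nonneg:
  assumes "S \<in> contractive_semigroups" "T \<in> contractive_semigroups" "K \<subseteq> orthant" "K \<noteq> {}"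
  shows "0 \<le> weak_dist K x y S T"
proof -
  obtain t where "t \<in> K" using assms by auto
  then show ?thesis
    unfolding weak_dist_def using assms by (intro cSUP_upper2[OF weak_dist_bdd, of _ _ _ t]) auto
qed

lemma weak_dist_refl: "K \<noteq> {} \<Longrightarrow> weak_dist K x y T T = 0"
  by (simp add: weak_dist_def cinner_zero_left)

lemma topspace_semigroup_topology: "topspace semigroup_topology = contractive_semigroups"
proof -
  have "T \<in> topspace semigroup_topology" if T: "T \<in> contractive_semigroups"
    for T :: "real ^ 'd \<Rightarrow> ('h::complex_inner \<Rightarrow>\<^sub>L 'h)"
  proof -
    let ?B = "{T' \<in> contractive_semigroups. weak_dist {0} 0 0 T' T < 1}"
    have "compact {0::real ^ 'd}" "{0} \<subseteq> (orthant :: (real ^ 'd) set)" "{0::real ^ 'd} \<noteq> {}"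
      by (simp_all add: orthant_def)
    then have "openin semigroup_topology ?B"
      unfolding semigroup_topology_def
      using T zero_less_one by (intro topology_generated_by_Basis CollectI exI conjI) (rule refl | assumption)+
    moreover have "T \<in> ?B"
      using T by (simp add: weak_dist_refl)
    ultimately show ?thesis
      by (meson in_mono openin_subset)
  qed
  then show ?thesis
    unfolding semigroup_topology_def topology_generated_by_topspace by blast
qed

lemma limitin_semigroup_topology:
  fixes T :: "real ^ 'd \<Rightarrow> ('h::complex_inner \<Rightarrow>\<^sub>L 'h)"
  shows "limitin semigroup_topology f T F \<longleftrightarrow>
    T \<in> contractive_semigroups \<and> (\<forall>\<^sub>F i in F. f i \<in> contractive_semigroups) \<and>
    (\<forall>x y K. compact K \<and> K \<subseteq> orthant \<and> K \<noteq> {} \<longrightarrow>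
       ((\<lambda>i. SUP t\<in>K. cmod (cinner ((f i t - T t) x) y)) \<longlongrightarrow> 0) F)"
    (is "?L \<longleftrightarrow> ?R")
proof
  assume L: ?L
  then have T: "T \<in> contractive_semigroups"
    by (metis limitin_topspace topspace_semigroup_topology)
  have ev: "\<forall>\<^sub>F i in F. f i \<in> contractive_semigroups"
    using L T unfolding limitin_def by (metis openin_topspace topspace_semigroup_topology)
  have "((\<lambda>i. weak_dist K x y (f i) T) \<longlongrightarrow> 0) F"
    if K: "compact K" "K \<subseteq> orthant" "K \<noteq> {}" for x y K
  proof (rule tendstoI)
    fix e :: real assume e: "0 < e"
    let ?B = "{T' \<in> contractive_semigroups. weak_dist K x y T' T < e}"
    have "openin semigroup_topology ?B"
      unfolding semigroup_topology_def by (rule topology_generated_by_Basis) (use K T e in blast)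
    moreover have "T \<in> ?B" using T K e by (simp add: weak_dist_refl)
    ultimately have "\<forall>\<^sub>F i in F. f i \<in> ?B" using L unfolding limitin_def by blast
    then show "\<forall>\<^sub>F i in F. dist (weak_dist K x y (f i) T) 0 < e"
    proof eventually_elim
      case (elim i)
      then show ?case
        using weak_dist_nonneg[of "f i" T K x y] K T by simp
    qed
  qed
  then show ?R using T ev by (simp add: weak_dist_def)
next
  assume R: ?R
  have gen: "\<forall>\<^sub>F i in F. f i \<in> U"
    if "generate_topology_on
         {{T \<in> contractive_semigroups. weak_dist K x y T S < e} | K x y S e.
           compact K \<and> K \<subseteq> orthant \<and> K \<noteq> {} \<and> S \<in> contractive_semigroups \<and> 0 < e} U"
       "T \<in> U" for U
    using that
  proof induction
    case Empty
    then show ?case by simp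
  next
    case (Int a b)
    then show ?case by (simp add: eventually_conj)
  next
    case (UN A)
    then obtain k where k: "k \<in> A" "T \<in> k" by blast
    then have "\<forall>\<^sub>F i in F. f i \<in> k" using UN by blast
    then show ?case by eventually_elim (use k in blast)
  next
    case (Basis B)
    then obtain K x y S e where B: "B = {T \<in> contractive_semigroups. weak_dist K x y T S < e}"
      and K: "compact K" "K \<subseteq> orthant" "K \<noteq> {}" and S: "S \<in> contractive_semigroups"
      by blast
    have T: "T \<in> contractive_semigroups" "weak_dist K x y T S < e"
      using Basis B by auto
    have "((\<lambda>i. weak_dist K x y (f i) T) \<longlongrightarrow> 0) F"
      using R K by (simp add: weak_dist_def)
    then have "\<forall>\<^sub>F i in F. weak_dist K x y (f i) T < e - weak_dist K x y T S"
      using T by (intro order_tendstoD(2)) auto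
    moreover have "\<forall>\<^sub>F i in F. f i \<in> contractive_semigroups" using R by blast
    ultimately show ?case
    proof eventually_elim
      case (elim i)
      then show ?case
        using weak_dist_triangle[of "f i" T S K x y] T S K by (simp add: B)
    qed
  qed
  show ?L
    unfolding limitin_def topspace_semigroup_topology
    using R gen by (auto simp: semigroup_topology_def openin_topology_generated_by_iff)
qed

definition Polish_topology :: "'a topology \<Rightarrow> bool"
  where "Polish_topology X \<longleftrightarrow> separable_space X \<and> completely_metrizable_space X"

end

theory Submission
  imports Defs
begin

text \<open>
Complete metrisability rests on the theorem that \<open>G\<^sub>\<delta>\<close> subsets of completely metrisable spaces are
completely metrisable.

Let \<open>w\<close> be a dense sequence in the Hilbert space. A contraction-valued function \<open>T\<close> on the orthant is
determined by its coefficients \<open>\<lambda>t. cinner (T t (w m)) (w n)\<close>. Divided by \<open>1 + norm t\<close>, each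
coefficient becomes a point of the complete metric space of bounded continuous functions, and
uniform weak convergence on compact sets becomes convergence in the countable product of these spaces
(\<open>homeomorphic_weighted_coefficients\<close>). It remains to see that the semigroups form a \<open>G\<^sub>\<delta>\<close> set.

The weakly continuous families of contractions form a closed set, because bounded sequences of operators
whose coefficients converge have weak limits (\<open>closed_weighted_coefficients\<close>). For contractive semigroups
weak and strong continuity coincide (\<open>contractive_semigroups_eq\<close>), so only the semigroup law
remains. In general that law is not preserved by weak limits, since in infinite dimensions multiplication is
not jointly weakly continuous. However, with an orthonormal expansion along vectors \<open>e i\<close>, the coefficient of \<open>T s o\<^sub>L T t\<close> between \<open>x\<close> and \<open>y\<close> is the limit
of the finite sums of \<open>cinner (T t x) (e i) * cinner (T s (e i)) y\<close> over \<open>i < N\<close>, each of which is continuous in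
\<open>T\<close>. The law at fixed \<open>s\<close>, \<open>t\<close>, \<open>x\<close>, \<open>y\<close> is thus the vanishing of a function of Baire class one, which is
a \<open>G\<^sub>\<delta>\<close> condition; by separate continuity, countably many \<open>s\<close>, \<open>t\<close>, \<open>x\<close>, \<open>y\<close> suffice
(\<open>semigroup_law_of_dense\<close>, \<open>gdelta_weighted_coefficients\<close>).

Separability comes from a countable network of sets that prescribe the approximate values of finitely
many coefficients on finitely many balls of times (\<open>separable_semigroup_topology\<close>).
\<close>

section \<open>Complex inner product spaces\<close>

lemma scaleR_eq_scaleC: "r *\<^sub>R (x::'h::complex_inner) = complex_of_real r *\<^sub>C x"
  by (rule scaleR_scaleC)

lemma bounded_bilinear_cinner: "bounded_bilinear (cinner :: 'h::complex_inner \<Rightarrow> 'h \<Rightarrow> complex)"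
proof
  fix x x' y y' :: 'h and r :: real
  show "cinner (x + x') y = cinner x y + cinner x' y"
    by (rule cinner_add_left)
  show "cinner x (y + y') = cinner x y + cinner x y'"
    by (metis cinner_add_left cinner_commute complex_cnj_add)
  show "cinner (r *\<^sub>R x) y = r *\<^sub>R cinner x y"
    by (simp add: scaleR_eq_scaleC cinner_scaleC_left scaleR_conv_of_real)
  show "cinner x (r *\<^sub>R y) = r *\<^sub>R cinner x y"
    using cinner_commute[of x "r *\<^sub>R y"] cinner_commute[of x y]
    by (simp add: scaleR_eq_scaleC cinner_scaleC_left scaleR_conv_of_real)
  show "\<exists>K. \<forall>a b::'h. cmod (cinner a b) \<le> norm a * norm b * K"
    by (intro exI[of _ 1] allI) (simp only: mult_1_right cinner_Cauchy_Schwarz)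
qed

interpretation cinner: bounded_bilinear "cinner :: 'h::complex_inner \<Rightarrow> 'h \<Rightarrow> complex"
  by (rule bounded_bilinear_cinner)

lemma cinner_scaleC_right: "cinner x (c *\<^sub>C y) = cnj c * cinner (x::'h::complex_inner) y"
  by (metis cinner_commute cinner_scaleC_left complex_cnj_cnj complex_cnj_mult)

lemma scaleC_diff_left: "(a - b) *\<^sub>C (x::'h::complex_inner) = a *\<^sub>C x - b *\<^sub>C x"
  by (metis add_diff_cancel diff_add_cancel scaleC_add_left)

lemma scaleC_zero_left [simp]: "0 *\<^sub>C (x::'h::complex_inner) = 0"
  by (metis norm_scaleC norm_zero mult_zero_left norm_eq_zero)

lemma scaleC_zero_right [simp]: "c *\<^sub>C (0::'h::complex_inner) = 0"
  by (metis norm_scaleC norm_zero mult_zero_right norm_eq_zero)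

lemma Re_cinner_self: "Re (cinner x x) = (norm (x::'h::complex_inner))\<^sup>2"
  by (simp add: norm_sq_cinner)

lemma Re_cinner_commute: "Re (cinner x y) = Re (cinner (y::'h::complex_inner) x)"
  by (metis cinner_commute complex_cnj cnj.simps(1))

lemma norm_add_square:
  "(norm (x + y))\<^sup>2 = (norm x)\<^sup>2 + (norm y)\<^sup>2 + 2 * Re (cinner x (y::'h::complex_inner))"
  using Re_cinner_commute[of y x]
  by (simp add: Re_cinner_self[symmetric] cinner.add_left cinner.add_right)

lemma norm_diff_square:
  "(norm (x - y))\<^sup>2 = (norm x)\<^sup>2 + (norm y)\<^sup>2 - 2 * Re (cinner x (y::'h::complex_inner))"
  using Re_cinner_commute[of y x]
  by (simp add: Re_cinner_self[symmetric] cinner.diff_left cinner.diff_right)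

lemma norm_le_of_cinner_le:
  assumes "\<And>y. cmod (cinner x y) \<le> C * norm (y::'h::complex_inner)" "0 \<le> C"
  shows "norm x \<le> C"
proof (cases "x = 0")
  case False
  have "(norm x)\<^sup>2 = cmod (cinner x x)"
    by (simp add: norm_sq_cinner norm_power)
  then have "norm x * norm x \<le> C * norm x"
    using assms(1)[of x] by (simp add: power2_eq_square)
  then show ?thesis
    using False by simp
qed (use assms in simp)

lemma cinner_ext:
  assumes "\<And>y. cinner x y = cinner x' (y::'h::complex_inner)"
  shows "x = x'"
proof -
  have "norm (x - x') \<le> 0"
    by (rule norm_le_of_cinner_le) (use assms in \<open>auto simp: cinner.diff_left\<close>)
  then show ?thesis by simp
qed

section \<open>Riesz representation and adjoints\<close>

text \<open>
The vector is found by a variational argument: the functional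
\<open>J x = (norm x)\<^sup>2 - 2 * Re (\<phi> x)\<close> is bounded below, the parallelogram identity makes every
minimising sequence Cauchy, and vanishing of the first variation of \<open>J\<close> at its minimiser \<open>v\<close> is the
identity \<open>Re (\<phi> x) = Re (cinner x v)\<close>. Replacing \<open>x\<close> by \<open>\<i> *\<^sub>C x\<close> gives the imaginary parts.
\<close>

theorem riesz_representation:
  fixes \<phi> :: "'h::complex_hilbert_space \<Rightarrow> complex"
  assumes add: "\<And>x y. \<phi> (x + y) = \<phi> x + \<phi> y"
    and scale: "\<And>c x. \<phi> (c *\<^sub>C x) = c * \<phi> x"
    and bound: "\<And>x. cmod (\<phi> x) \<le> C * norm x"
  shows "\<exists>v. \<forall>x. \<phi> x = cinner x v"
proof -
  define J where "J x = (norm x)\<^sup>2 - 2 * Re (\<phi> x)" for x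
  have scaleR: "\<phi> (r *\<^sub>R x) = r *\<^sub>R \<phi> x" for r x
    by (simp add: scaleR_eq_scaleC scale scaleR_conv_of_real)
  have lin: "bounded_linear \<phi>"
    using bound by (intro bounded_linear_intro[where K=C]) (auto simp: add scaleR mult.commute)
  have lower: "- C\<^sup>2 \<le> J x" for x
  proof -
    have "Re (\<phi> x) \<le> C * norm x"
      using complex_Re_le_cmod[of "\<phi> x"] bound[of x] by linarith
    moreover have "0 \<le> (norm x - C)\<^sup>2" by simp
    ultimately show ?thesis
      unfolding J_def power2_diff by (simp add: mult.commute)
  qed
  have bdd: "bdd_below (range J)"
    using lower by (intro bdd_belowI2) auto
  define I where "I = Inf (range J)"
  have I_le: "I \<le> J x" for x
    unfolding I_def by (rule cINF_lower[OF bdd]) simp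
  have "\<exists>x. J x < I + inverse (Suc n)" for n
  proof -
    have "Inf (range J) < I + inverse (Suc n)" by (simp add: I_def)
    then show ?thesis
      using cInf_less_iff[OF _ bdd] by auto
  qed
  then obtain u where u: "J (u n) < I + inverse (Suc n)" for n
    by metis
  \<comment> \<open>The midpoint of two near-minimisers cannot do better than \<open>I\<close>, so they are close together.\<close>
  have par: "(norm (x - y))\<^sup>2 \<le> 2 * (J x - I) + 2 * (J y - I)" for x y
  proof -
    have "J ((1/2) *\<^sub>R (x + y)) = (norm (x + y))\<^sup>2 / 4 - (Re (\<phi> x) + Re (\<phi> y))"
      by (simp add: J_def scaleR add power_mult_distrib power2_eq_square add_divide_distrib)
    moreover have "(norm (x + y))\<^sup>2 + (norm (x - y))\<^sup>2 = 2 * (norm x)\<^sup>2 + 2 * (norm y)\<^sup>2"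
      by (simp add: norm_add_square norm_diff_square)
    ultimately show ?thesis
      using I_le[of "(1/2) *\<^sub>R (x + y)"] by (simp add: J_def)
  qed
  have "Cauchy u"
  proof (rule metric_CauchyI)
    fix e :: real assume e: "0 < e"
    then obtain M where M: "inverse (Suc M) < e\<^sup>2 / 4"
      using reals_Archimedean[of "e\<^sup>2 / 4"] by auto
    have small: "J (u n) - I < e\<^sup>2 / 4" if "M \<le> n" for n
    proof -
      have "inverse (real (Suc n)) \<le> inverse (real (Suc M))"
        using that by (simp add: field_simps)
      then show ?thesis using u[of n] M by linarith
    qed
    have "dist (u m) (u n) < e" if "M \<le> m" "M \<le> n" for m n
    proof -
      have "(norm (u m - u n))\<^sup>2 \<le> 2 * (J (u m) - I) + 2 * (J (u n) - I)"
        by (rule par)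
      also have "\<dots> < 2 * (e\<^sup>2 / 4) + 2 * (e\<^sup>2 / 4)"
        using small[OF that(1)] small[OF that(2)] by (intro add_strict_mono) auto
      finally have "(norm (u m - u n))\<^sup>2 < e\<^sup>2" by simp
      then show ?thesis
        using e by (simp add: dist_norm power_less_imp_less_base)
    qed
    then show "\<exists>M. \<forall>m\<ge>M. \<forall>n\<ge>M. dist (u m) (u n) < e" by blast
  qed
  then obtain v where v: "u \<longlonglongrightarrow> v"
    using Cauchy_convergent convergent_def by blast
  have "(\<lambda>n. J (u n)) \<longlonglongrightarrow> J v"
    unfolding J_def by (intro tendsto_intros v bounded_linear.tendsto[OF lin])
  moreover have "(\<lambda>n. I + inverse (real (Suc n))) \<longlonglongrightarrow> I + 0"
    by (intro tendsto_intros LIMSEQ_inverse_real_of_nat)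
  ultimately have "J v \<le> I + 0"
    by (rule LIMSEQ_le) (use u in \<open>auto intro: less_imp_le\<close>)
  then have min: "J v \<le> J x" for x
    using I_le[of x] by simp
  have Re_eq: "Re (\<phi> x) = Re (cinner x v)" for x
  proof (rule ccontr)
    define d where "d = Re (\<phi> x) - Re (cinner x v)"
    assume "Re (\<phi> x) \<noteq> Re (cinner x v)"
    then have d: "d \<noteq> 0" by (simp add: d_def)
    \<comment> \<open>A step of this length along \<open>x\<close> would lower \<open>J\<close>; the summand 1 only guards against \<open>x = 0\<close>.\<close>
    define t where "t = d / ((norm x)\<^sup>2 + 1)"
    have "J (v + t *\<^sub>R x) = J v + t\<^sup>2 * (norm x)\<^sup>2 - 2 * t * d"
      by (simp add: J_def norm_add_square add scaleR cinner.scaleR_right d_def power_mult_distrib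
          Re_cinner_commute[of v x] algebra_simps)
    then have "2 * t * d \<le> t\<^sup>2 * (norm x)\<^sup>2"
      using min[of "v + t *\<^sub>R x"] by linarith
    also have "\<dots> \<le> t\<^sup>2 * ((norm x)\<^sup>2 + 1)"
      by (simp add: mult_left_mono)
    also have "\<dots> = t * d"
      by (simp add: t_def power2_eq_square)
    finally have "t * d \<le> 0" by (simp add: mult.commute)
    moreover have "0 < t * d"
      using d by (simp add: t_def zero_less_divide_iff add_nonneg_pos flip: power2_eq_square)
    ultimately show False by simp
  qed
  have "\<phi> x = cinner x v" for x
  proof (rule complex_eqI)
    have "Im z = - Re (\<i> * z)" for z by simp
    then show "Im (\<phi> x) = Im (cinner x v)"
      using Re_eq[of "\<i> *\<^sub>C x"] by (simp add: scale cinner_scaleC_left)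
  qed (rule Re_eq)
  then show ?thesis by blast
qed

text \<open>
The vector \<open>v\<close> is the value at \<open>y\<close> of the adjoint of \<open>S\<close>. It shows that \<open>S\<close> respects weak limits: the
coefficient of \<open>S x\<close> against \<open>y\<close> is a coefficient of \<open>x\<close>.
\<close>

lemma adjoint_vector:
  fixes S :: "'h::complex_hilbert_space \<Rightarrow>\<^sub>L 'h"
  assumes "\<And>c x. S (c *\<^sub>C x) = c *\<^sub>C S x"
  shows "\<exists>v. \<forall>x. cinner (S x) y = cinner x v"
proof (rule riesz_representation)
  fix x
  have "cmod (cinner (S x) y) \<le> (norm S * norm x) * norm y"
    by (meson cinner_Cauchy_Schwarz mult_right_mono norm_blinfun norm_ge_zero order_trans)
  then show "cmod (cinner (S x) y) \<le> (norm S * norm y) * norm x"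
    by (simp add: mult_ac)
qed (auto simp: assms cinner_scaleC_left cinner_add_left blinfun.add_right)

text \<open>
The set of complex-linear contractions is sequentially complete for the weak operator topology:
the limits of the coefficients form a bounded sesquilinear form, and Riesz representation in the
second variable turns the form into an operator.
\<close>

lemma weak_limit_of_contractions:
  fixes S :: "nat \<Rightarrow> 'h::complex_hilbert_space \<Rightarrow>\<^sub>L 'h"
  assumes hom: "\<And>j c x. S j (c *\<^sub>C x) = c *\<^sub>C S j x"
    and norm: "\<And>j. norm (S j) \<le> 1"
    and conv: "\<And>x y. convergent (\<lambda>j. cinner (S j x) y)"
  shows "\<exists>R. (\<forall>c x. blinfun_apply R (c *\<^sub>C x) = c *\<^sub>C R x) \<and> norm R \<le> 1 \<and>
    (\<forall>x y. (\<lambda>j. cinner (S j x) y) \<longlonglongrightarrow> cinner (R x) y)"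
proof -
  define B where "B x y = lim (\<lambda>j. cinner (S j x) y)" for x y
  have B: "(\<lambda>j. cinner (S j x) y) \<longlonglongrightarrow> B x y" for x y
    using conv by (simp add: B_def convergent_LIMSEQ_iff)
  have B_bound: "cmod (B x y) \<le> norm x * norm y" for x y
  proof (rule LIMSEQ_le_const2[OF tendsto_norm[OF B]])
    have "cmod (cinner (S j x) y) \<le> (1 * norm x) * norm y" for j
      by (meson cinner_Cauchy_Schwarz mult_right_mono norm norm_blinfun norm_ge_zero order_trans)
    then show "\<exists>N. \<forall>n\<ge>N. cmod (cinner (S n x) y) \<le> norm x * norm y" by simp
  qed
  have "\<exists>v. \<forall>y. cnj (B x y) = cinner y v" for x
  proof (rule riesz_representation)
    show "cnj (B x (y + z)) = cnj (B x y) + cnj (B x z)" for y z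
      using LIMSEQ_unique[OF B[of x "y + z"]] tendsto_add[OF B[of x y] B[of x z]]
      by (simp add: cinner.add_right)
    show "cnj (B x (c *\<^sub>C y)) = c * cnj (B x y)" for c y
      using LIMSEQ_unique[OF B[of x "c *\<^sub>C y"]] tendsto_mult_left[OF B[of x y], of "cnj c"]
      by (simp add: cinner_scaleC_right)
    show "cmod (cnj (B x y)) \<le> norm x * norm y" for y
      using B_bound by simp
  qed
  then obtain R where "cnj (B x y) = cinner y (R x)" for x y
    by metis
  then have R: "B x y = cinner (R x) y" for x y
    by (metis cinner_commute complex_cnj_cnj)
  have R_add: "R (x + x') = R x + R x'" for x x'
  proof (rule cinner_ext)
    show "cinner (R (x + x')) y = cinner (R x + R x') y" for y
      using LIMSEQ_unique[OF B[of "x + x'" y]] tendsto_add[OF B[of x y] B[of x' y]]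
      by (simp add: cinner.add_left blinfun.add_right R)
  qed
  have R_scale: "R (c *\<^sub>C x) = c *\<^sub>C R x" for c x
  proof (rule cinner_ext)
    show "cinner (R (c *\<^sub>C x)) y = cinner (c *\<^sub>C R x) y" for y
      using LIMSEQ_unique[OF B[of "c *\<^sub>C x" y]] tendsto_mult_left[OF B[of x y], of c]
      by (simp add: cinner_scaleC_left hom R)
  qed
  have R_norm: "norm (R x) \<le> norm x" for x
    by (rule norm_le_of_cinner_le) (use B_bound[of x] in \<open>auto simp: R\<close>)
  have lin: "bounded_linear R"
    by (rule bounded_linear_intro[where K=1])
      (auto simp: R_add R_scale R_norm scaleR_eq_scaleC)
  show ?thesis
  proof (intro exI conjI allI)
    show "norm (Blinfun R) \<le> 1"
      by (rule norm_blinfun_bound) (auto simp: bounded_linear_Blinfun_apply[OF lin] R_norm)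
  qed (use B in \<open>auto simp: bounded_linear_Blinfun_apply[OF lin] R_scale R\<close>)
qed

section \<open>Orthonormal expansions along a dense sequence\<close>

text \<open>
No linear independence is assumed of \<open>h\<close>: since \<open>sgn 0 = 0\<close>, a vector that depends linearly on its
predecessors contributes a zero vector. The same recursion therefore also serves
finite-dimensional spaces.
\<close>

fun gram_schmidt :: "(nat \<Rightarrow> 'h::complex_inner) \<Rightarrow> nat \<Rightarrow> 'h" where
  "gram_schmidt h n =
     sgn (h n - (\<Sum>i<n. cinner (h n) (gram_schmidt h i) *\<^sub>C gram_schmidt h i))"

declare gram_schmidt.simps [simp del]

definition partial_expansion :: "(nat \<Rightarrow> 'h::complex_inner) \<Rightarrow> nat \<Rightarrow> 'h \<Rightarrow> 'h"
  where "partial_expansion e N x = (\<Sum>i<N. cinner x (e i) *\<^sub>C e i)"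

definition orthonormal_or_zero :: "(nat \<Rightarrow> 'h::complex_inner) \<Rightarrow> bool"
  where "orthonormal_or_zero e \<longleftrightarrow>
    (\<forall>i j. i \<noteq> j \<longrightarrow> cinner (e i) (e j) = 0) \<and> (\<forall>i. e i = 0 \<or> norm (e i) = 1)"

lemma partial_expansion_diff:
  "partial_expansion e N (x - y) = partial_expansion e N x - partial_expansion e N y"
  by (simp add: partial_expansion_def cinner.diff_left scaleC_diff_left sum_subtractf)

lemma partial_expansion_add:
  "partial_expansion e N (x + y) = partial_expansion e N x + partial_expansion e N y"
  by (simp add: partial_expansion_def cinner.add_left scaleC_add_left sum.distrib)

lemma cinner_partial_expansion:
  assumes "orthonormal_or_zero e" "j < N"
  shows "cinner (partial_expansion e N x) (e j) = cinner x (e j)"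
proof -
  have "cinner (partial_expansion e N x) (e j) = (\<Sum>i<N. cinner x (e i) * cinner (e i) (e j))"
    by (simp add: partial_expansion_def cinner.sum_left cinner_scaleC_left)
  also have "\<dots> = (\<Sum>i<N. if i = j then cinner x (e j) * cinner (e j) (e j) else 0)"
    using assms by (intro sum.cong) (auto simp: orthonormal_or_zero_def)
  also have "\<dots> = cinner x (e j) * cinner (e j) (e j)"
    using assms by simp
  also have "\<dots> = cinner x (e j)"
  proof -
    have "e j = 0 \<or> norm (e j) = 1"
      using assms by (auto simp: orthonormal_or_zero_def)
    then show ?thesis
      by (auto simp: norm_sq_cinner cinner.zero_right)
  qed
  finally show ?thesis .
qed

lemma partial_expansion_basis_vector:
  assumes "orthonormal_or_zero e" "j < N"
  shows "partial_expansion e N (e j) = e j"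
proof -
  have "partial_expansion e N (e j) = (\<Sum>i<N. if i = j then cinner (e j) (e j) *\<^sub>C e j else 0)"
    unfolding partial_expansion_def
    using assms by (intro sum.cong) (auto simp: orthonormal_or_zero_def)
  also have "\<dots> = cinner (e j) (e j) *\<^sub>C e j"
    using assms by simp
  also have "\<dots> = e j"
  proof -
    have "e j = 0 \<or> norm (e j) = 1"
      using assms by (auto simp: orthonormal_or_zero_def)
    then show ?thesis
      by (auto simp: norm_sq_cinner scaleC_one)
  qed
  finally show ?thesis .
qed

text \<open>
This is Bessel's inequality: \<open>partial_expansion e N\<close> is the orthogonal projection onto the span of the
first \<open>N\<close> vectors, so the squared norm of \<open>partial_expansion e N x\<close> is its inner product with \<open>x\<close>.
\<close>

lemma norm_partial_expansion_le:
  assumes "orthonormal_or_zero e"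
  shows "norm (partial_expansion e N x) \<le> norm x"
proof -
  let ?P = "partial_expansion e N x"
  have "cinner ?P ?P = (\<Sum>i<N. cnj (cinner x (e i)) * cinner ?P (e i))"
    by (subst (2) partial_expansion_def) (simp add: cinner.sum_right cinner_scaleC_right)
  also have "\<dots> = (\<Sum>i<N. cnj (cinner x (e i)) * cinner x (e i))"
    using assms by (intro sum.cong) (auto simp: cinner_partial_expansion)
  also have "\<dots> = cinner x ?P"
    by (simp add: partial_expansion_def cinner.sum_right cinner_scaleC_right)
  finally have "(norm ?P)\<^sup>2 = cmod (cinner x ?P)"
    by (metis norm_of_real norm_sq_cinner abs_of_nonneg zero_le_power2)
  then have "norm ?P * norm ?P \<le> norm x * norm ?P"
    using cinner_Cauchy_Schwarz[of x ?P] by (simp add: power2_eq_square)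
  then show ?thesis
    by (cases "norm ?P = 0") (auto simp: mult_le_cancel_right)
qed

lemma orthonormal_gram_schmidt: "orthonormal_or_zero (gram_schmidt h)"
proof -
  let ?e = "gram_schmidt h"
  have norm: "?e i = 0 \<or> norm (?e i) = 1" for i
    by (subst (1 2) gram_schmidt.simps) (simp add: norm_sgn sgn_zero_iff)
  have orth: "\<forall>i<N. \<forall>j<N. i \<noteq> j \<longrightarrow> cinner (?e i) (?e j) = 0" for N
  proof (induction N)
    case (Suc n)
    \<comment> \<open>Cutting the sequence off at \<open>n\<close> makes the induction hypothesis an instance of orthonormality.\<close>
    define e where "e i = (if i < n then ?e i else 0)" for i
    have on: "orthonormal_or_zero e"
      using Suc norm by (auto simp: orthonormal_or_zero_def e_def cinner.zero_left cinner.zero_right)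
    have new: "cinner (?e n) (?e j) = 0" if j: "j < n" for j
    proof -
      have "?e n = sgn (h n - partial_expansion e n (h n))"
        by (subst gram_schmidt.simps) (simp add: partial_expansion_def e_def)
      moreover have "cinner (h n - partial_expansion e n (h n)) (e j) = 0"
        using cinner_partial_expansion[OF on j] by (simp add: cinner.diff_left)
      ultimately show ?thesis
        using j by (simp add: sgn_div_norm cinner.scaleR_left e_def)
    qed
    then have "cinner (?e j) (?e n) = 0" if "j < n" for j
      using that by (metis cinner_commute complex_cnj_zero)
    with new Suc show ?case
      by (metis less_Suc_eq)
  qed simp
  show ?thesis
    unfolding orthonormal_or_zero_def using norm orth
    by (metis less_Suc_eq linorder_less_linear)
qed

text \<open>
By construction \<open>h n\<close> is a combination of the first \<open>n + 1\<close> Gram--Schmidt vectors, and the projection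
fixes each of these.
\<close>

lemma partial_expansion_gram_schmidt:
  assumes "n < N"
  shows "partial_expansion (gram_schmidt h) N (h n) = h n"
proof -
  let ?e = "gram_schmidt h"
  have fix_sum: "partial_expansion ?e N (c *\<^sub>C ?e i) = c *\<^sub>C ?e i" if "i < N" for i c
  proof -
    have "partial_expansion ?e N (c *\<^sub>C ?e i) = c *\<^sub>C partial_expansion ?e N (?e i)"
      by (simp add: partial_expansion_def cinner_scaleC_left scaleC_scaleC[symmetric])
         (induction N, auto simp: scaleC_add_right)
    then show ?thesis
      using that by (simp add: partial_expansion_basis_vector orthonormal_gram_schmidt)
  qed
  have fix_part: "partial_expansion ?e N (\<Sum>i<m. c i *\<^sub>C ?e i) = (\<Sum>i<m. c i *\<^sub>C ?e i)"
    if "m \<le> N" for m c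
    using that
  proof (induction m)
    case 0
    then show ?case by (simp add: partial_expansion_def cinner.zero_left)
  next
    case (Suc m)
    then show ?case by (simp add: partial_expansion_add fix_sum)
  qed
  let ?g = "h n - (\<Sum>i<n. cinner (h n) (?e i) *\<^sub>C ?e i)"
  have "?g = norm ?g *\<^sub>R ?e n"
    by (subst gram_schmidt.simps[of h n]) (cases "?g = 0", simp_all add: sgn_div_norm)
  then have "h n = (\<Sum>i<n. cinner (h n) (?e i) *\<^sub>C ?e i) + complex_of_real (norm ?g) *\<^sub>C ?e n"
    unfolding scaleR_eq_scaleC by (simp only: diff_eq_eq add.commute)
  then obtain a r where hn: "h n = (\<Sum>i<n. a i *\<^sub>C ?e i) + r *\<^sub>C ?e n"
    by (rule that)
  have "partial_expansion ?e N (h n) = partial_expansion ?e N ((\<Sum>i<n. a i *\<^sub>C ?e i) + r *\<^sub>C ?e n)"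
    using hn by (rule arg_cong)
  also have "\<dots> = h n"
    unfolding partial_expansion_add fix_part[OF less_imp_le[OF assms]] fix_sum[OF assms]
    using hn by (rule sym)
  finally show ?thesis .
qed

text \<open>
The projections are contractions that eventually fix each member of a dense sequence.
\<close>

lemma partial_expansion_gram_schmidt_tendsto:
  assumes "closure (range h) = UNIV"
  shows "(\<lambda>N. partial_expansion (gram_schmidt h) N x) \<longlonglongrightarrow> x"
proof (rule LIMSEQ_I)
  fix r :: real assume r: "0 < r"
  then obtain n where n: "dist (h n) x < r / 2"
    using assms closure_approachable[of x "range h"] by (auto dest!: spec[of _ "r / 2"])
  let ?P = "partial_expansion (gram_schmidt h)"
  have "norm (?P N x - x) < r" if "N \<ge> Suc n" for N
  proof -
    have "?P N x - x = ?P N (x - h n) + (h n - x)"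
      using that by (simp add: partial_expansion_diff partial_expansion_gram_schmidt)
    then have "norm (?P N x - x) \<le> norm (?P N (x - h n)) + norm (h n - x)"
      by (metis norm_triangle_ineq)
    also have "\<dots> \<le> norm (x - h n) + norm (h n - x)"
      using norm_partial_expansion_le[OF orthonormal_gram_schmidt] by simp
    finally show ?thesis
      using n by (simp add: dist_norm norm_minus_commute)
  qed
  then show "\<exists>no. \<forall>N\<ge>no. norm (?P N x - x) < r" by blast
qed

text \<open>
A single sequence \<open>w\<close> has to serve two purposes. Its density makes coefficients along \<open>w\<close> determine
operators and topologies; the orthonormal subsequence \<open>w \<circ> k\<close> allows the coefficients of a product of
two operators to be computed from the coefficients of the factors. A dense sequence is interleaved with
its own Gram--Schmidt vectors.
\<close>

lemma dense_sequence_with_expansion: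
  assumes "separable_space (euclidean :: 'h::complex_inner topology)"
  obtains w :: "nat \<Rightarrow> 'h::complex_inner" and k :: "nat \<Rightarrow> nat" where
    "closure (range w) = UNIV"
    "\<And>x. (\<lambda>N. partial_expansion (w \<circ> k) N x) \<longlonglongrightarrow> x"
proof -
  obtain C :: "'h set" where C: "countable C" "closure C = UNIV"
    using assms by (auto simp: separable_space_def)
  then have "C \<noteq> {}" by auto
  then obtain h :: "nat \<Rightarrow> 'h" where h: "range h = C"
    using C uncountable_def by blast
  define w where "w n = (if even n then h (n div 2) else gram_schmidt h (n div 2))" for n :: nat
  have "w (2 * i) = h i" for i by (simp add: w_def)
  then have "range h \<subseteq> range w"
    by (metis image_subset_iff rangeI)
  then have "closure (range w) = UNIV"
    using C h closure_mono by blast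
  moreover have "w \<circ> (\<lambda>i. Suc (2 * i)) = gram_schmidt h"
    by (auto simp: w_def)
  moreover have "closure (range h) = UNIV" using C h by simp
  ultimately show thesis
    using that partial_expansion_gram_schmidt_tendsto by metis
qed

section \<open>Weakly continuous families of contractions\<close>

text \<open>
These families satisfy every condition on a contractive semigroup except the two algebraic ones, and
their continuity is only weak. Weak continuity survives locally uniform weak limits, so the families form
a closed set; the semigroups among them in general do not.
\<close>

definition contraction_families :: "(real ^ 'd \<Rightarrow> ('h::complex_inner \<Rightarrow>\<^sub>L 'h)) set"
  where "contraction_families =
    {T \<in> extensional orthant.
       (\<forall>t\<in>orthant. \<forall>c x. blinfun_apply (T t) (c *\<^sub>C x) = c *\<^sub>C blinfun_apply (T t) x) \<and>
       (\<forall>t\<in>orthant. norm (T t) \<le> 1) \<and>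
       (\<forall>x y. continuous_on orthant (\<lambda>t. cinner (T t x) y))}"

lemma zero_in_orthant [simp]: "0 \<in> orthant"
  by (simp add: orthant_def)

lemma add_in_orthant: "s \<in> orthant \<Longrightarrow> t \<in> orthant \<Longrightarrow> s + t \<in> orthant"
  by (simp add: orthant_def)

lemma closed_orthant: "closed (orthant :: (real ^ 'd) set)"
proof -
  have "orthant = (\<Inter>i. {t :: real ^ 'd. 0 \<le> t $ i})"
    by (auto simp: orthant_def)
  also have "closed \<dots>"
    by (intro closed_INT ballI closed_Collect_le continuous_intros)
  finally show ?thesis .
qed

lemma compact_orthant_cball: "compact (orthant \<inter> cball (0 :: real ^ 'd) r)"
  by (metis closed_Int_compact closed_orthant compact_cball)

lemma contraction_familiesD:
  assumes "T \<in> contraction_families" "t \<in> orthant"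
  shows "T t (c *\<^sub>C x) = c *\<^sub>C T t x" "norm (T t) \<le> 1"
  using assms by (auto simp: contraction_families_def)

lemma continuous_on_contraction_families:
  "T \<in> contraction_families \<Longrightarrow> continuous_on orthant (\<lambda>t. cinner (T t x) y)"
  by (auto simp: contraction_families_def)

lemma cmod_cinner_contraction_le:
  fixes S :: "'h::complex_inner \<Rightarrow>\<^sub>L 'h"
  assumes "norm S \<le> 1"
  shows "cmod (cinner (S x) y) \<le> norm x * norm y"
proof -
  have "norm (S x) \<le> 1 * norm x"
    by (meson assms mult_right_mono norm_blinfun norm_ge_zero order_trans)
  then show ?thesis
    by (metis cinner_Cauchy_Schwarz mult_1 mult_right_mono norm_ge_zero order_trans)
qed

text \<open>
The same pair of indices serves all contractions at once. This uniformity lets continuity, convergence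
and uniform convergence pass from coefficients along a dense sequence to all coefficients.
\<close>

lemma contraction_coefficient_approximation:
  fixes x y :: "'h::complex_inner"
  assumes dense: "closure (range w) = UNIV" and e: "0 < e"
  shows "\<exists>m n. \<forall>S. norm S \<le> 1 \<longrightarrow>
    cmod (cinner (blinfun_apply S x) y - cinner (blinfun_apply S (w m)) (w n)) < e"
proof -
  have approx: "\<exists>m. norm (z - w m) < d" if "0 < d" for z d
    using dense closure_approachable[of z "range w"] that
    by (auto simp: dist_norm norm_minus_commute)
  define d where "d = e / 2 / (norm y + 1)"
  have "0 < d" using e by (simp add: d_def add_nonneg_pos)
  then obtain m where m: "norm (x - w m) < d" using approx by blast
  define d' where "d' = e / 2 / (norm (w m) + 1)"
  have "0 < d'" using e by (simp add: d'_def add_nonneg_pos)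
  then obtain n where n: "norm (y - w n) < d'" using approx by blast
  have "cmod (cinner (S x) y - cinner (S (w m)) (w n)) < e" if S: "norm S \<le> 1" for S :: "'h \<Rightarrow>\<^sub>L 'h"
  proof -
    have "cinner (S x) y - cinner (S (w m)) (w n)
        = cinner (S (x - w m)) y + cinner (S (w m)) (y - w n)"
      by (simp add: blinfun.diff_right cinner.diff_left cinner.diff_right)
    then have "cmod (cinner (S x) y - cinner (S (w m)) (w n))
        \<le> norm (x - w m) * norm y + norm (w m) * norm (y - w n)"
      using cmod_cinner_contraction_le[OF S] by (metis add_mono norm_triangle_mono)
    moreover have "norm (x - w m) * norm y \<le> norm (x - w m) * (norm y + 1)"
      by (simp add: mult_left_mono)
    moreover have "norm (x - w m) * (norm y + 1) < e / 2"
      using m unfolding d_def by (subst (asm) pos_less_divide_eq) (auto simp: add_nonneg_pos)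
    moreover have "norm (w m) * norm (y - w n) \<le> (norm (w m) + 1) * norm (y - w n)"
      by (simp add: mult_right_mono)
    moreover have "(norm (w m) + 1) * norm (y - w n) < e / 2"
      using n unfolding d'_def by (subst (asm) pos_less_divide_eq) (auto simp: add_nonneg_pos mult.commute)
    ultimately show ?thesis by linarith
  qed
  then show ?thesis by blast
qed

lemma continuous_on_coefficients_of_dense:
  fixes T :: "'a::metric_space \<Rightarrow> ('h::complex_inner \<Rightarrow>\<^sub>L 'h)"
  assumes dense: "closure (range w) = UNIV"
    and norm: "\<And>t. t \<in> A \<Longrightarrow> norm (T t) \<le> 1"
    and cont: "\<And>m n. continuous_on A (\<lambda>t. cinner (T t (w m)) (w n))"
  shows "continuous_on A (\<lambda>t. cinner (T t x) y)"
  unfolding continuous_on_iff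
proof (intro ballI allI impI)
  fix t and e :: real assume t: "t \<in> A" and e: "0 < e"
  then obtain m n where mn: "cmod (cinner (T s x) y - cinner (T s (w m)) (w n)) < e / 3"
    if "s \<in> A" for s
    using contraction_coefficient_approximation[OF dense, of "e / 3" x y] norm by auto
  obtain d where d: "0 < d" and
    close: "\<And>s. s \<in> A \<Longrightarrow> dist s t < d \<Longrightarrow>
      dist (cinner (T s (w m)) (w n)) (cinner (T t (w m)) (w n)) < e / 3"
    using cont[of m n] t e unfolding continuous_on_iff by (metis divide_pos_pos zero_less_numeral)
  have "dist (cinner (T s x) y) (cinner (T t x) y) < e" if s: "s \<in> A" "dist s t < d" for s
    using mn[OF s(1)] mn[OF t] close[OF s] unfolding dist_norm by norm
  then show "\<exists>d>0. \<forall>s\<in>A. dist s t < d \<longrightarrow> dist (cinner (T s x) y) (cinner (T t x) y) < e"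
    using d by blast
qed

lemma convergent_coefficients_of_dense:
  fixes S :: "nat \<Rightarrow> ('h::complex_inner \<Rightarrow>\<^sub>L 'h)"
  assumes dense: "closure (range w) = UNIV"
    and norm: "\<And>j. norm (S j) \<le> 1"
    and conv: "\<And>m n. convergent (\<lambda>j. cinner (S j (w m)) (w n))"
  shows "convergent (\<lambda>j. cinner (S j x) y)"
proof -
  have "Cauchy (\<lambda>j. cinner (S j x) y)"
  proof (rule metric_CauchyI)
    fix e :: real assume e: "0 < e"
    then obtain m n where mn: "\<And>j. cmod (cinner (S j x) y - cinner (S j (w m)) (w n)) < e / 3"
      using contraction_coefficient_approximation[OF dense, of "e / 3" x y] norm by auto
    obtain M where M: "\<And>i j. i \<ge> M \<Longrightarrow> j \<ge> M \<Longrightarrow>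
        dist (cinner (S i (w m)) (w n)) (cinner (S j (w m)) (w n)) < e / 3"
      using convergent_Cauchy[OF conv, of m n] e unfolding Cauchy_def
      by (metis divide_pos_pos zero_less_numeral)
    have "dist (cinner (S i x) y) (cinner (S j x) y) < e" if "i \<ge> M" "j \<ge> M" for i j
      using mn[of i] mn[of j] M[OF that] unfolding dist_norm by norm
    then show "\<exists>M. \<forall>i\<ge>M. \<forall>j\<ge>M. dist (cinner (S i x) y) (cinner (S j x) y) < e" by blast
  qed
  then show ?thesis by (rule Cauchy_convergent)
qed

lemma blinfun_eq_of_dense_coefficients:
  fixes R S :: "'h::complex_inner \<Rightarrow>\<^sub>L 'h"
  assumes dense: "closure (range w) = UNIV"
    and eq: "\<And>m n. cinner (R (w m)) (w n) = cinner (S (w m)) (w n)"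
  shows "R = S"
proof -
  have fun_eq: "f = g" if "continuous_on UNIV f" "continuous_on UNIV g" "\<And>n. f (w n) = g (w n)"
    for f g :: "'h \<Rightarrow> complex"
  proof
    fix x
    have "closed {x. f x = g x}"
      using that by (intro closed_Collect_eq) auto
    then have "closure (range w) \<subseteq> {x. f x = g x}"
      using that by (intro closure_minimal) auto
    then show "f x = g x" using dense by blast
  qed
  have "(\<lambda>y. cinner (R (w m)) y) = (\<lambda>y. cinner (S (w m)) y)" for m
    using eq by (intro fun_eq linear_continuous_on cinner.bounded_linear_right)
  then have eq': "cinner (R (w m)) y = cinner (S (w m)) y" for m y
    by metis
  have "(\<lambda>x. cinner (R x) y) = (\<lambda>x. cinner (S x) y)" for y
    using eq'
    by (intro fun_eq linear_continuous_on
        bounded_linear_compose[OF cinner.bounded_linear_left blinfun.bounded_linear_right])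
  then show ?thesis
    by (intro blinfun_eqI cinner_ext) metis
qed

section \<open>Weakly continuous contraction semigroups are strongly continuous\<close>

text \<open>
For a contraction \<open>S\<close> one has \<open>(norm (S x - x))\<^sup>2 \<le> 2 * (norm x)\<^sup>2 - 2 * Re (cinner (S x) x)\<close>, so weak
continuity at the origin is already strong continuity there. The semigroup law and contractivity carry it
to all other points.
\<close>

lemma weakly_continuous_semigroup_strongly_continuous:
  fixes T :: "real ^ 'd \<Rightarrow> ('h::complex_inner \<Rightarrow>\<^sub>L 'h)"
  assumes T: "T \<in> contraction_families" and T0: "T 0 = id_blinfun"
    and mult: "\<And>s t. s \<in> orthant \<Longrightarrow> t \<in> orthant \<Longrightarrow> T (s + t) = T s o\<^sub>L T t"
  shows "continuous_on orthant (\<lambda>t. T t x)"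
proof -
  have norm_le: "norm (T t z) \<le> norm z" if "t \<in> orthant" for t z
  proof -
    have "norm (T t z) \<le> norm (T t) * norm z" by (rule norm_blinfun)
    also have "\<dots> \<le> 1 * norm z"
      using contraction_familiesD(2)[OF T that] by (intro mult_right_mono) auto
    finally show ?thesis by simp
  qed
  \<comment> \<open>Strong continuity at the origin.\<close>
  have "((\<lambda>t. T t x) \<longlongrightarrow> x) (at 0 within orthant)"
  proof -
    have "((\<lambda>t. cinner (T t x) x) \<longlongrightarrow> cinner (T 0 x) x) (at 0 within orthant)"
      using continuous_on_contraction_families[OF T, of x x] by (auto simp: continuous_on)
    then have "((\<lambda>t. 2 * (norm x)\<^sup>2 - 2 * Re (cinner (T t x) x)) \<longlongrightarrow>
        2 * (norm x)\<^sup>2 - 2 * Re (cinner x x)) (at 0 within orthant)"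
      by (intro tendsto_intros) (simp add: T0)
    then have "((\<lambda>t. 2 * (norm x)\<^sup>2 - 2 * Re (cinner (T t x) x)) \<longlongrightarrow> 0) (at 0 within orthant)"
      by (simp add: Re_cinner_self)
    then have lim: "((\<lambda>t. sqrt (2 * (norm x)\<^sup>2 - 2 * Re (cinner (T t x) x))) \<longlongrightarrow> 0) (at 0 within orthant)"
      using tendsto_real_sqrt by fastforce
    have "((\<lambda>t. T t x - x) \<longlongrightarrow> 0) (at 0 within orthant)"
    proof (rule Lim_null_comparison[OF _ lim])
      have "norm (T t x - x) \<le> sqrt (2 * (norm x)\<^sup>2 - 2 * Re (cinner (T t x) x))" if "t \<in> orthant" for t
      proof (rule real_le_rsqrt)
        have "(norm (T t x))\<^sup>2 \<le> (norm x)\<^sup>2"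
          using norm_le[OF that] by (intro power_mono) auto
        then show "(norm (T t x - x))\<^sup>2 \<le> 2 * (norm x)\<^sup>2 - 2 * Re (cinner (T t x) x)"
          by (simp add: norm_diff_square)
      qed
      then show "\<forall>\<^sub>F t in at 0 within orthant.
          norm (T t x - x) \<le> sqrt (2 * (norm x)\<^sup>2 - 2 * Re (cinner (T t x) x))"
        by (simp add: eventually_at_filter)
    qed
    then show ?thesis by (simp add: LIM_zero_iff)
  qed
  then have zero: "\<exists>d>0. \<forall>u\<in>orthant. norm u < d \<longrightarrow> norm (T u x - x) < e" if "0 < e" for e
  proof -
    have "continuous (at 0 within orthant) (\<lambda>t. T t x)"
      using \<open>((\<lambda>t. T t x) \<longlongrightarrow> x) (at 0 within orthant)\<close> by (simp add: continuous_within T0)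
    then show ?thesis
      using that unfolding continuous_within_eps_delta by (simp add: dist_norm T0)
  qed
  show ?thesis
    unfolding continuous_on_iff
  proof (intro ballI allI impI)
    fix t :: "real ^ 'd" and e :: real assume t: "t \<in> orthant" and e: "0 < e"
    obtain d where d: "0 < d" and
      small: "\<And>u. u \<in> orthant \<Longrightarrow> norm u < d \<Longrightarrow> norm (T u x - x) < e / 2"
      using zero[of "e / 2"] e by auto
    have "dist (T s x) (T t x) < e" if s: "s \<in> orthant" "dist s t < d" for s
    proof -
      \<comment> \<open>Two points of the orthant need not be comparable; both are compared with their meet.\<close>
      define r where "r = (\<chi> i. min (s $ i) (t $ i))"
      have r: "r \<in> orthant" "s - r \<in> orthant" "t - r \<in> orthant"
        using s t by (auto simp: orthant_def r_def)
      have "norm (s - r) \<le> norm (s - t)" "norm (t - r) \<le> norm (s - t)"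
        by (rule norm_le_componentwise_cart; simp add: r_def)+
      then have rd: "norm (s - r) < d" "norm (t - r) < d"
        using s by (auto simp: dist_norm)
      have "T s x = T r (T (s - r) x)" "T t x = T r (T (t - r) x)"
        using mult[OF r(1,2)] mult[OF r(1,3)] by simp_all
      then have "dist (T s x) (T t x) = norm (T r (T (s - r) x - T (t - r) x))"
        by (simp add: dist_norm blinfun.diff_right)
      also have "\<dots> \<le> norm (T (s - r) x - T (t - r) x)"
        by (rule norm_le[OF r(1)])
      also have "\<dots> < e"
        using small[OF r(2) rd(1)] small[OF r(3) rd(2)] by norm
      finally show ?thesis .
    qed
    then show "\<exists>d>0. \<forall>s\<in>orthant. dist s t < d \<longrightarrow> dist (T s x) (T t x) < e"
      using d by blast
  qed
qed

text \<open>
Strong continuity may thus be replaced by weak continuity in the definition of a contractive semigroup,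
which leaves the semigroup law as the only condition that weak limits can destroy.
\<close>

theorem contractive_semigroups_eq:
  "contractive_semigroups = {T \<in> contraction_families.
     T 0 = id_blinfun \<and> (\<forall>s\<in>orthant. \<forall>t\<in>orthant. T (s + t) = T s o\<^sub>L T t)}"
proof -
  have strong: "continuous_map (top_of_set orthant) strong_operator_topology T \<longleftrightarrow>
      (\<forall>x. continuous_on orthant (\<lambda>t. T t x))" for T :: "real ^ 'd \<Rightarrow> ('h::complex_inner \<Rightarrow>\<^sub>L 'h)"
    by (simp add: continuous_on_strong_operator_topo_iff_coordinatewise)
  have "continuous_on orthant (\<lambda>t. cinner (T t x) y)"
    if "\<forall>x. continuous_on orthant (\<lambda>t. T t x)" for x y and T :: "real ^ 'd \<Rightarrow> ('h::complex_inner \<Rightarrow>\<^sub>L 'h)"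
    using that by (intro cinner.continuous_on continuous_on_const) auto
  then show ?thesis
    unfolding contractive_semigroups_def strong
    using weakly_continuous_semigroup_strongly_continuous
    by (fastforce simp: contraction_families_def)
qed

section \<open>Weighted matrix coefficients\<close>

text \<open>
A norm-preserving retraction onto the orthant. It turns a family on the orthant into functions on the
whole space, which are elements of the complete metric space of bounded continuous functions.
\<close>

definition fold_to_orthant :: "real ^ 'd \<Rightarrow> real ^ 'd"
  where "fold_to_orthant t = (\<chi> i. \<bar>t $ i\<bar>)"

lemma fold_to_orthant [simp]:
  "fold_to_orthant t \<in> orthant"
  "t \<in> orthant \<Longrightarrow> fold_to_orthant t = t"
  "norm (fold_to_orthant t) = norm t"
  by (auto simp: fold_to_orthant_def orthant_def vec_eq_iff norm_vec_def)

lemma continuous_on_fold_to_orthant: "continuous_on A fold_to_orthant"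
  unfolding fold_to_orthant_def by (intro continuous_intros)

text \<open>
Dividing by \<open>1 + norm t\<close> makes the supremum norm induce locally uniform convergence: the
coefficients of contractions are uniformly bounded, so their weighted values are uniformly small outside
a large compact set.
\<close>

definition weighted_coefficients ::
    "(nat \<Rightarrow> 'h) \<Rightarrow> (real ^ 'd \<Rightarrow> ('h::complex_inner \<Rightarrow>\<^sub>L 'h)) \<Rightarrow> nat \<times> nat \<Rightarrow> ((real ^ 'd) \<Rightarrow>\<^sub>C complex)"
  where "weighted_coefficients w T p =
    Bcontfun (\<lambda>t. cinner (T (fold_to_orthant t) (w (fst p))) (w (snd p)) /\<^sub>R (1 + norm t))"

lemma norm_pos_weight: "0 < 1 + norm t" "1 + norm t \<noteq> 0"
  by (auto simp: add_pos_nonneg add_nonneg_eq_0_iff)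

lemma apply_weighted_coefficients:
  fixes T :: "real ^ 'd \<Rightarrow> ('h::complex_inner \<Rightarrow>\<^sub>L 'h)"
  assumes T: "T \<in> contraction_families"
  shows "apply_bcontfun (weighted_coefficients w T (m, n)) t =
    cinner (T (fold_to_orthant t) (w m)) (w n) /\<^sub>R (1 + norm t)"
proof -
  let ?f = "\<lambda>t. cinner (T (fold_to_orthant t) (w m)) (w n) /\<^sub>R (1 + norm t)"
  have "?f \<in> bcontfun"
  proof (rule bcontfun_normI)
    have "continuous_on UNIV (\<lambda>t. cinner (T (fold_to_orthant t) (w m)) (w n))"
      by (rule continuous_on_compose2[OF continuous_on_contraction_families[OF T]
            continuous_on_fold_to_orthant]) auto
    then show "continuous_on UNIV ?f"
      by (intro continuous_intros) (auto simp: norm_pos_weight)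
    show "norm (?f t) \<le> norm (w m) * norm (w n)" for t
    proof -
      have "norm (?f t) \<le> cmod (cinner (T (fold_to_orthant t) (w m)) (w n)) * 1"
        by (simp only: norm_scaleR mult.commute[of "norm (cinner _ _)"])
           (intro mult_right_mono, auto simp: inverse_le_1_iff norm_pos_weight)
      also have "\<dots> \<le> norm (w m) * norm (w n)"
        using cmod_cinner_contraction_le[OF contraction_familiesD(2)[OF T]] by simp
      finally show ?thesis .
    qed
  qed
  then show ?thesis
    by (simp add: weighted_coefficients_def Bcontfun_inverse)
qed

lemma coefficient_eq_weighted:
  assumes "T \<in> contraction_families" "t \<in> orthant"
  shows "cinner (T t (w m)) (w n) =
    (1 + norm t) *\<^sub>R apply_bcontfun (weighted_coefficients w T (m, n)) t"
  using assms by (simp add: apply_weighted_coefficients norm_pos_weight)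

lemma inj_on_weighted_coefficients:
  assumes dense: "closure (range w) = UNIV"
  shows "inj_on (weighted_coefficients w)
    (contraction_families :: (real ^ 'd \<Rightarrow> ('h::complex_inner \<Rightarrow>\<^sub>L 'h)) set)"
proof (rule inj_onI)
  fix S T :: "real ^ 'd \<Rightarrow> ('h \<Rightarrow>\<^sub>L 'h)"
  assume S: "S \<in> contraction_families" and T: "T \<in> contraction_families"
    and eq: "weighted_coefficients w S = weighted_coefficients w T"
  show "S = T"
  proof (rule extensionalityI[of _ orthant])
    show "S t = T t" if "t \<in> orthant" for t
      by (rule blinfun_eq_of_dense_coefficients[OF dense])
        (simp add: coefficient_eq_weighted[OF S that] coefficient_eq_weighted[OF T that] eq)
  qed (use S T in \<open>auto simp: contraction_families_def\<close>)
qed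

lemma contractive_semigroups_subset: "contractive_semigroups \<subseteq> contraction_families"
  by (auto simp: contractive_semigroups_eq)

lemma weak_dist_upper:
  assumes "S \<in> contractive_semigroups" "T \<in> contractive_semigroups" "K \<subseteq> orthant" "t \<in> K"
  shows "cmod (cinner ((S t - T t) x) y) \<le> weak_dist K x y S T"
  unfolding weak_dist_def using assms by (intro cSUP_upper weak_dist_bdd)

lemma weak_dist_least:
  fixes S T :: "real ^ 'd \<Rightarrow> ('h::complex_inner \<Rightarrow>\<^sub>L 'h)"
  assumes "K \<noteq> {}" "\<And>t. t \<in> K \<Longrightarrow> cmod (cinner ((S t - T t) x) y) \<le> c"
  shows "weak_dist K x y S T \<le> c"
  unfolding weak_dist_def using assms by (rule cSUP_least)

text \<open>
Replacing \<open>x\<close> and \<open>y\<close> by suitable members of \<open>w\<close> changes every coefficient of every contraction by little,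
uniformly in \<open>t\<close>.
\<close>

lemma limitin_semigroup_topology_of_dense:
  fixes T :: "real ^ 'd \<Rightarrow> ('h::complex_inner \<Rightarrow>\<^sub>L 'h)"
  assumes dense: "closure (range w) = UNIV"
    and T: "T \<in> contractive_semigroups" and f: "\<forall>\<^sub>F i in F. f i \<in> contractive_semigroups"
    and lim: "\<And>m n K. compact K \<Longrightarrow> K \<subseteq> orthant \<Longrightarrow> K \<noteq> {} \<Longrightarrow>
      ((\<lambda>i. weak_dist K (w m) (w n) (f i) T) \<longlongrightarrow> 0) F"
  shows "limitin semigroup_topology f T F"
proof -
  have "((\<lambda>i. weak_dist K x y (f i) T) \<longlongrightarrow> 0) F"
    if K: "compact K" "K \<subseteq> orthant" "K \<noteq> {}" for x y K
  proof (rule tendstoI)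
    fix e :: real assume e: "0 < e"
    then obtain m n where mn: "\<And>S. norm S \<le> 1 \<Longrightarrow>
        cmod (cinner (blinfun_apply S x) y - cinner (blinfun_apply S (w m)) (w n)) < e / 4"
      using contraction_coefficient_approximation[OF dense, of "e / 4" x y] by auto
    have "\<forall>\<^sub>F i in F. weak_dist K (w m) (w n) (f i) T < e / 4"
      using lim[OF K] e by (intro order_tendstoD(2)) auto
    with f show "\<forall>\<^sub>F i in F. dist (weak_dist K x y (f i) T) 0 < e"
    proof eventually_elim
      case (elim i)
      have "weak_dist K x y (f i) T \<le> 3 * (e / 4)"
      proof (rule weak_dist_least[OF K(3)])
        fix t assume t: "t \<in> K"
        then have "norm (f i t) \<le> 1" "norm (T t) \<le> 1"
          using contraction_familiesD(2) contractive_semigroups_subset T elim(1) K(2) by blast+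
        then have "cmod (cinner (f i t x) y - cinner (f i t (w m)) (w n)) < e / 4"
          "cmod (cinner (T t x) y - cinner (T t (w m)) (w n)) < e / 4"
          using mn by auto
        moreover have "cmod (cinner ((f i t - T t) (w m)) (w n)) \<le> e / 4"
          using weak_dist_upper[OF elim(1) T K(2) t] elim(2) by (meson le_less_trans less_imp_le)
        moreover have "cinner ((f i t - T t) x) y
            = (cinner (f i t x) y - cinner (f i t (w m)) (w n))
              + cinner ((f i t - T t) (w m)) (w n) - (cinner (T t x) y - cinner (T t (w m)) (w n))"
          by (simp add: blinfun.diff_left cinner.diff_left)
        moreover have "cmod (a + c - b) \<le> 3 * (e / 4)"
          if "cmod a < e / 4" "cmod b < e / 4" "cmod c \<le> e / 4" for a b c
          using that by norm
        ultimately show "cmod (cinner ((f i t - T t) x) y) \<le> 3 * (e / 4)"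
          by presburger
      qed
      moreover have "0 \<le> weak_dist K x y (f i) T"
        by (rule weak_dist_nonneg[OF elim(1) T K(2,3)])
      ultimately show ?case using e by simp
    qed
  qed
  then show ?thesis
    using T f by (simp add: limitin_semigroup_topology weak_dist_def)
qed

lemma dist_weighted_coefficients:
  fixes S T :: "real ^ 'd \<Rightarrow> ('h::complex_inner \<Rightarrow>\<^sub>L 'h)"
  assumes S: "S \<in> contraction_families" and T: "T \<in> contraction_families"
  shows "dist (apply_bcontfun (weighted_coefficients w S (m, n)) t)
      (apply_bcontfun (weighted_coefficients w T (m, n)) t) =
    cmod (cinner ((S (fold_to_orthant t) - T (fold_to_orthant t)) (w m)) (w n)) / (1 + norm t)"
  unfolding apply_weighted_coefficients[OF S] apply_weighted_coefficients[OF T]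
  by (simp add: dist_norm scaleR_diff_right[symmetric] cinner.diff_left[symmetric]
      blinfun.diff_left[symmetric] norm_pos_weight divide_inverse mult.commute)

text \<open>
Arbitrary filters are needed here: the semigroup topology is given by a subbasis of pseudometric balls
and is not yet known to be first countable, so sequences would not determine it.
\<close>

lemma limitin_semigroup_topology_iff_weighted_coefficients:
  fixes T :: "real ^ 'd \<Rightarrow> ('h::complex_inner \<Rightarrow>\<^sub>L 'h)"
  assumes dense: "closure (range w) = UNIV"
    and T: "T \<in> contractive_semigroups" and f: "\<forall>\<^sub>F i in F. f i \<in> contractive_semigroups"
  shows "limitin semigroup_topology f T F \<longleftrightarrow>
    (\<forall>p. ((\<lambda>i. weighted_coefficients w (f i) p) \<longlongrightarrow> weighted_coefficients w T p) F)"
proof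
  assume lim: "limitin semigroup_topology f T F"
  have "((\<lambda>i. weighted_coefficients w (f i) (m, n)) \<longlongrightarrow> weighted_coefficients w T (m, n)) F" for m n
  proof (rule tendstoI)
    fix e :: real assume e: "0 < e"
    define c where "c = 2 * norm (w m) * norm (w n)"
    have "0 \<le> c" by (simp add: c_def)
    \<comment> \<open>Outside \<open>K\<close> the weight alone brings the difference of two contractions below \<open>e / 2\<close>.\<close>
    define K where "K = (orthant :: (real ^ 'd) set) \<inter> cball 0 (2 * c / e)"
    have K: "compact K" "K \<subseteq> orthant" "K \<noteq> {}"
      using compact_orthant_cball \<open>0 \<le> c\<close> e zero_in_orthant
      by (auto simp: K_def disjoint_iff intro!: exI[of _ 0])
    have "((\<lambda>i. weak_dist K (w m) (w n) (f i) T) \<longlongrightarrow> 0) F"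
      using lim K by (simp add: limitin_semigroup_topology weak_dist_def)
    then have "\<forall>\<^sub>F i in F. weak_dist K (w m) (w n) (f i) T < e / 2"
      using e by (intro order_tendstoD(2)) auto
    with f show "\<forall>\<^sub>F i in F. dist (weighted_coefficients w (f i) (m, n)) (weighted_coefficients w T (m, n)) < e"
    proof eventually_elim
      case (elim i)
      have "dist (weighted_coefficients w (f i) (m, n)) (weighted_coefficients w T (m, n)) \<le> e / 2"
      proof (rule dist_bound)
        fix t :: "real ^ 'd"
        let ?v = "cmod (cinner ((f i (fold_to_orthant t) - T (fold_to_orthant t)) (w m)) (w n))"
        have "?v / (1 + norm t) \<le> e / 2"
        proof (cases "norm t \<le> 2 * c / e")
          case True
          then have "?v \<le> e / 2"
            using weak_dist_upper[OF elim(1) T K(2), of "fold_to_orthant t" "w m" "w n"] elim(2)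
            by (simp add: K_def)
          moreover have "e / 2 * 1 \<le> e / 2 * (1 + norm t)"
            using e by (intro mult_left_mono) auto
          ultimately show ?thesis
            by (simp add: pos_divide_le_eq norm_pos_weight)
        next
          case False
          have "?v \<le> c"
            unfolding c_def by (rule weak_dist_bound[OF elim(1) T]) simp
          also have "c \<le> e / 2 * norm t"
            using False e by (simp add: field_simps)
          also have "\<dots> \<le> e / 2 * (1 + norm t)"
            using e by (intro mult_left_mono) auto
          finally show ?thesis
            by (simp add: pos_divide_le_eq norm_pos_weight)
        qed
        then show "dist (apply_bcontfun (weighted_coefficients w (f i) (m, n)) t)
            (apply_bcontfun (weighted_coefficients w T (m, n)) t) \<le> e / 2"
          using elim(1) T contractive_semigroups_subset
          by (subst dist_weighted_coefficients) auto
      qed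
      then show ?case using e by simp
    qed
  qed
  then show "\<forall>p. ((\<lambda>i. weighted_coefficients w (f i) p) \<longlongrightarrow> weighted_coefficients w T p) F"
    by auto
next
  assume lim: "\<forall>p. ((\<lambda>i. weighted_coefficients w (f i) p) \<longlongrightarrow> weighted_coefficients w T p) F"
  show "limitin semigroup_topology f T F"
  proof (rule limitin_semigroup_topology_of_dense[OF dense T f])
    fix m n and K :: "(real ^ 'd) set"
    assume K: "compact K" "K \<subseteq> orthant" "K \<noteq> {}"
    obtain r where r: "0 < r" "\<And>t. t \<in> K \<Longrightarrow> norm t \<le> r"
      using compact_imp_bounded[OF K(1)] bounded_pos by blast
    let ?d = "\<lambda>i. dist (weighted_coefficients w (f i) (m, n)) (weighted_coefficients w T (m, n))"
    have "((\<lambda>i. (1 + r) * ?d i) \<longlongrightarrow> (1 + r) * 0) F"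
      using lim[rule_format, of "(m, n)"] by (intro tendsto_mult_left) (simp only: tendsto_dist_iff[symmetric])
    then have lim0: "((\<lambda>i. (1 + r) * ?d i) \<longlongrightarrow> 0) F" by simp
    have "\<forall>\<^sub>F i in F. norm (weak_dist K (w m) (w n) (f i) T) \<le> (1 + r) * ?d i"
      using f
    proof eventually_elim
      case (elim i)
      have "weak_dist K (w m) (w n) (f i) T \<le> (1 + r) * ?d i"
      proof (rule weak_dist_least[OF K(3)])
        fix t assume t: "t \<in> K"
        then have [simp]: "fold_to_orthant t = t" using K(2) by auto
        have "cmod (cinner ((f i t - T t) (w m)) (w n)) / (1 + norm t) \<le> ?d i"
          using dist_weighted_coefficients[OF subsetD[OF contractive_semigroups_subset elim]
              subsetD[OF contractive_semigroups_subset T], of w m n t]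
            dist_bounded[of "weighted_coefficients w (f i) (m, n)" t "weighted_coefficients w T (m, n)"]
          by simp
        then have "cmod (cinner ((f i t - T t) (w m)) (w n)) \<le> ?d i * (1 + norm t)"
          by (simp add: pos_divide_le_eq norm_pos_weight)
        also have "\<dots> \<le> ?d i * (1 + r)"
          using r(2)[OF t] by (intro mult_left_mono) auto
        finally show "cmod (cinner ((f i t - T t) (w m)) (w n)) \<le> (1 + r) * ?d i"
          by (simp add: mult.commute)
      qed
      then show ?case
        using weak_dist_nonneg[OF elim T K(2,3)] by simp
    qed
    then show "((\<lambda>i. weak_dist K (w m) (w n) (f i) T) \<longlongrightarrow> 0) F"
      by (rule Lim_null_comparison) (rule lim0)
  qed
qed

lemma limitin_atin_ident: "x \<in> topspace X \<Longrightarrow> limitin X (\<lambda>y. y) x (atin X x)"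
  by (rule limitin_continuous_map) auto

text \<open>
Both directions are checked at a point through the filter of its neighbourhoods, where the preceding
characterisation of limits applies.
\<close>

theorem homeomorphic_weighted_coefficients:
  fixes w :: "nat \<Rightarrow> 'h::complex_inner"
  assumes dense: "closure (range w) = UNIV"
  shows "(semigroup_topology :: (real ^ 'd \<Rightarrow> ('h \<Rightarrow>\<^sub>L 'h)) topology) homeomorphic_space
    subtopology euclidean
      (weighted_coefficients w ` (contractive_semigroups :: (real ^ 'd \<Rightarrow> ('h \<Rightarrow>\<^sub>L 'h)) set))"
proof -
  let ?X = "semigroup_topology :: (real ^ 'd \<Rightarrow> ('h \<Rightarrow>\<^sub>L 'h)) topology"
  let ?C = "contractive_semigroups :: (real ^ 'd \<Rightarrow> ('h \<Rightarrow>\<^sub>L 'h)) set"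
  let ?\<Phi> = "weighted_coefficients w :: (real ^ 'd \<Rightarrow> ('h \<Rightarrow>\<^sub>L 'h)) \<Rightarrow> _"
  let ?Y = "subtopology euclidean (?\<Phi> ` ?C)"
  define g where "g = inv_into ?C ?\<Phi>"
  have inj: "inj_on ?\<Phi> ?C"
    using inj_on_weighted_coefficients[OF dense] contractive_semigroups_subset by (rule inj_on_subset)
  have gC: "g q \<in> ?C" "?\<Phi> (g q) = q" if "q \<in> ?\<Phi> ` ?C" for q
    using that by (auto simp: g_def inv_into_into f_inv_into_f)
  have "continuous_map ?X euclidean (\<lambda>T. ?\<Phi> T p)" for p
    unfolding continuous_map_atin
  proof (intro ballI)
    fix T assume T: "T \<in> topspace ?X"
    have id: "limitin ?X (\<lambda>T. T) T (atin ?X T)"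
      using T by (rule limitin_atin_ident)
    then have "\<forall>\<^sub>F S in atin ?X T. S \<in> ?C"
      by (simp add: limitin_semigroup_topology)
    then have "\<forall>p. ((\<lambda>S. ?\<Phi> S p) \<longlongrightarrow> ?\<Phi> T p) (atin ?X T)"
      using id T unfolding topspace_semigroup_topology
      by (subst (asm) limitin_semigroup_topology_iff_weighted_coefficients[OF dense])
    then show "limitin euclidean (\<lambda>T. ?\<Phi> T p) (?\<Phi> T p) (atin ?X T)"
      unfolding limitin_canonical_iff by blast
  qed
  then have "continuous_map ?X euclidean ?\<Phi>"
    by (metis continuous_map_componentwise_UNIV euclidean_product_topology)
  then have cont1: "continuous_map ?X ?Y ?\<Phi>"
    by (auto simp: continuous_map_in_subtopology topspace_semigroup_topology)
  have cont2: "continuous_map ?Y ?X g"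
    unfolding continuous_map_atin
  proof (intro ballI)
    fix q assume "q \<in> topspace ?Y"
    then have q: "q \<in> ?\<Phi> ` ?C" by simp
    have "limitin ?Y (\<lambda>q. q) q (atin ?Y q)"
      using q by (intro limitin_atin_ident) simp
    then have lim: "((\<lambda>q. q) \<longlongrightarrow> q) (atin ?Y q)" and ev: "\<forall>\<^sub>F r in atin ?Y q. r \<in> ?\<Phi> ` ?C"
      by (auto simp: limitin_subtopology)
    have "\<forall>\<^sub>F r in atin ?Y q. g r \<in> ?C"
      using ev by eventually_elim (rule gC)
    then show "limitin ?X g (g q) (atin ?Y q)"
    proof (subst limitin_semigroup_topology_iff_weighted_coefficients[OF dense gC(1)[OF q]])
      show "\<forall>p. ((\<lambda>r. ?\<Phi> (g r) p) \<longlongrightarrow> ?\<Phi> (g q) p) (atin ?Y q)"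
      proof
        fix p
        have "((\<lambda>r. r p) \<longlongrightarrow> q p) (atin ?Y q)"
          by (rule continuous_on_tendsto_compose[OF continuous_on_product_coordinates[of p] lim]) auto
        moreover have "\<forall>\<^sub>F r in atin ?Y q. r p = ?\<Phi> (g r) p"
          using ev by eventually_elim (simp add: gC(2))
        ultimately show "((\<lambda>r. ?\<Phi> (g r) p) \<longlongrightarrow> ?\<Phi> (g q) p) (atin ?Y q)"
          unfolding gC(2)[OF q] by (rule Lim_transform_eventually)
      qed
    qed
  qed
  have "homeomorphic_maps ?X ?Y ?\<Phi> g"
    unfolding homeomorphic_maps_def
    using cont1 cont2 inj gC by (auto simp: topspace_semigroup_topology g_def)
  then show ?thesis
    unfolding homeomorphic_space_def by blast
qed

section \<open>The coefficients of contraction families form a closed set\<close>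

lemma tendsto_apply_bcontfun:
  fixes f :: "'i \<Rightarrow> 'p \<Rightarrow> ('a::topological_space \<Rightarrow>\<^sub>C 'b::metric_space)"
  assumes "(f \<longlongrightarrow> l) F"
  shows "((\<lambda>i. apply_bcontfun (f i p) t) \<longlongrightarrow> apply_bcontfun (l p) t) F"
proof -
  have "((\<lambda>i. f i p) \<longlongrightarrow> l p) F"
    by (rule continuous_on_tendsto_compose[OF continuous_on_product_coordinates[of p] assms]) auto
  then show ?thesis
    using tendsto_uniform_limitI tendsto_bcontfun_uniform_limit by fastforce
qed

lemma continuous_on_apply_bcontfun_coordinate:
  "continuous_on A (\<lambda>f. apply_bcontfun ((f :: 'p \<Rightarrow> ('a::topological_space \<Rightarrow>\<^sub>C 'b::metric_space)) p) t)"
  unfolding continuous_on_def by (intro ballI tendsto_apply_bcontfun tendsto_ident_at)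

text \<open>
If the weighted coefficients of a sequence of contraction families converge, then at each time the
operators converge weakly, by boundedness and density. The limit operators are contractions, and their
coefficients are locally uniform limits of continuous functions.
\<close>

theorem closed_weighted_coefficients:
  fixes w :: "nat \<Rightarrow> 'h::complex_hilbert_space"
  assumes dense: "closure (range w) = UNIV"
  shows "closed (weighted_coefficients w `
    (contraction_families :: (real ^ 'd \<Rightarrow> ('h \<Rightarrow>\<^sub>L 'h)) set))"
  unfolding closed_sequential_limits
proof (intro allI impI, elim conjE)
  fix f and l :: "nat \<times> nat \<Rightarrow> (real ^ 'd) \<Rightarrow>\<^sub>C complex"
  assume "\<forall>j. f j \<in> weighted_coefficients w `
      (contraction_families :: (real ^ 'd \<Rightarrow> ('h \<Rightarrow>\<^sub>L 'h)) set)"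
    and lim: "f \<longlonglongrightarrow> l"
  then obtain T :: "nat \<Rightarrow> real ^ 'd \<Rightarrow> ('h \<Rightarrow>\<^sub>L 'h)"
    where T: "\<And>j. T j \<in> contraction_families" and f: "\<And>j. f j = weighted_coefficients w (T j)"
    unfolding image_iff by metis
  have lim_w: "(\<lambda>j. cinner (T j t (w m)) (w n)) \<longlonglongrightarrow> (1 + norm t) *\<^sub>R apply_bcontfun (l (m, n)) t"
    if "t \<in> orthant" for t m n
    unfolding coefficient_eq_weighted[OF T that]
    using tendsto_apply_bcontfun[OF lim, of "(m, n)" t] by (intro tendsto_intros) (simp add: f)
  have "\<exists>R. (\<forall>c x. blinfun_apply R (c *\<^sub>C x) = c *\<^sub>C R x) \<and> norm R \<le> 1 \<and>
      (\<forall>x y. (\<lambda>j. cinner (T j t x) y) \<longlonglongrightarrow> cinner (R x) y)" if t: "t \<in> orthant" for t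
  proof (rule weak_limit_of_contractions)
    show "convergent (\<lambda>j. cinner (T j t x) y)" for x y
    proof (rule convergent_coefficients_of_dense[OF dense contraction_familiesD(2)[OF T t]])
      show "convergent (\<lambda>j. cinner (T j t (w m)) (w n))" for m n
        using lim_w[OF t] by (rule convergentI)
    qed
  qed (rule contraction_familiesD[OF T t])+
  then obtain R where hom: "\<And>t c x. t \<in> orthant \<Longrightarrow> blinfun_apply (R t) (c *\<^sub>C x) = c *\<^sub>C R t x"
    and norm: "\<And>t. t \<in> orthant \<Longrightarrow> norm (R t) \<le> 1"
    and limR: "\<And>t x y. t \<in> orthant \<Longrightarrow> (\<lambda>j. cinner (T j t x) y) \<longlonglongrightarrow> cinner (R t x) y"
    by metis
  define S where "S = restrict R orthant"
  have S: "S t = R t" if "t \<in> orthant" for t using that by (simp add: S_def)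
  have "continuous_on orthant (\<lambda>t. cinner (S t x) y)" for x y
  proof (rule continuous_on_coefficients_of_dense[OF dense])
    fix m n
    have "continuous_on orthant (\<lambda>t. (1 + norm t) *\<^sub>R apply_bcontfun (l (m, n)) t)"
      by (intro continuous_intros continuous_on_apply_bcontfun)
    moreover have "cinner (S t (w m)) (w n) = (1 + norm t) *\<^sub>R apply_bcontfun (l (m, n)) t"
      if "t \<in> orthant" for t
      using LIMSEQ_unique[OF limR[OF that] lim_w[OF that]] S[OF that] by simp
    ultimately show "continuous_on orthant (\<lambda>t. cinner (S t (w m)) (w n))"
      by (simp cong: continuous_on_cong)
  qed (simp add: S norm)
  then have S_in: "S \<in> contraction_families"
    using hom norm by (auto simp: contraction_families_def S_def)
  have "weighted_coefficients w S p = l p" for p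
  proof (rule bcontfun_eqI)
    fix t
    obtain m n where p: "p = (m, n)" by fastforce
    have "(\<lambda>j. cinner (T j (fold_to_orthant t) (w m)) (w n) /\<^sub>R (1 + norm t))
        \<longlonglongrightarrow> cinner (S (fold_to_orthant t) (w m)) (w n) /\<^sub>R (1 + norm t)"
      using limR[of "fold_to_orthant t" "w m" "w n"] S by (intro tendsto_intros) simp
    then have "(\<lambda>j. apply_bcontfun (f j p) t) \<longlonglongrightarrow> apply_bcontfun (weighted_coefficients w S p) t"
      by (simp only: f p apply_weighted_coefficients[OF T] apply_weighted_coefficients[OF S_in])
    then show "apply_bcontfun (weighted_coefficients w S p) t = apply_bcontfun (l p) t"
      using LIMSEQ_unique tendsto_apply_bcontfun[OF lim] by blast
  qed
  then have "l = weighted_coefficients w S" by auto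
  then show "l \<in> weighted_coefficients w ` contraction_families"
    using S_in by blast
qed

section \<open>The semigroup law is a countable intersection of open conditions\<close>

text \<open>
In infinite dimensions multiplication is not jointly continuous for the weak operator topology, but by this expansion
its coefficients are pointwise limits of functions that are: the partial sums involve only finitely many
coefficients of the factors.
\<close>

lemma tendsto_product_coefficient:
  fixes S :: "'h::complex_inner \<Rightarrow>\<^sub>L 'h"
  assumes hom: "\<And>c x. S (c *\<^sub>C x) = c *\<^sub>C S x"
    and expansion: "(\<lambda>N. partial_expansion e N z) \<longlonglongrightarrow> z"
  shows "(\<lambda>N. \<Sum>i<N. cinner z (e i) * cinner (S (e i)) y) \<longlonglongrightarrow> cinner (S z) y"
proof -
  have "(\<Sum>i<N. cinner z (e i) * cinner (S (e i)) y) = cinner (S (partial_expansion e N z)) y" for N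
    by (simp add: partial_expansion_def blinfun.sum_right cinner.sum_left hom cinner_scaleC_left)
  then show ?thesis
    using expansion by (simp only:) (intro cinner.tendsto tendsto_const blinfun.tendsto)
qed

text \<open>
The right-hand side is a countable intersection of unions of conditions \<open>dist (s N) a < r\<close>. If \<open>s\<close>
and \<open>a\<close> depend continuously on a parameter, it describes a \<open>G\<^sub>\<delta>\<close> set of parameters; this is the
fact that preimages of closed sets under functions of Baire class one are \<open>G\<^sub>\<delta>\<close>.
\<close>

lemma LIMSEQ_eq_iff_frequently_close:
  fixes s :: "nat \<Rightarrow> 'a::metric_space"
  assumes s: "s \<longlonglongrightarrow> L"
  shows "L = a \<longleftrightarrow> (\<forall>j M. \<exists>N\<ge>M. dist (s N) a < inverse (Suc j))"
proof
  assume "L = a"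
  show "\<forall>j M. \<exists>N\<ge>M. dist (s N) a < inverse (Suc j)"
  proof (intro allI)
    fix j M
    obtain M' where "\<forall>N\<ge>M'. dist (s N) a < inverse (Suc j)"
      using s \<open>L = a\<close> unfolding lim_sequentially by (metis inverse_positive_iff_positive of_nat_0_less_iff zero_less_Suc)
    then show "\<exists>N\<ge>M. dist (s N) a < inverse (Suc j)"
      by (intro exI[of _ "max M M'"]) auto
  qed
next
  assume close: "\<forall>j M. \<exists>N\<ge>M. dist (s N) a < inverse (Suc j)"
  show "L = a"
  proof (rule ccontr)
    assume "L \<noteq> a"
    then have "0 < dist L a / 2" by simp
    then obtain j where j: "inverse (Suc j) < dist L a / 2"
      using reals_Archimedean by blast
    obtain M where M: "\<And>N. N \<ge> M \<Longrightarrow> dist (s N) L < dist L a / 2"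
      using s \<open>0 < dist L a / 2\<close> unfolding lim_sequentially by blast
    obtain N where N: "N \<ge> M" "dist (s N) a < inverse (Suc j)" using close by blast
    have "dist L a \<le> dist (s N) L + dist (s N) a"
      by (metis dist_commute dist_triangle)
    then show False using M[OF N(1)] N(2) j by linarith
  qed
qed

lemma continuous_on_orthant_eq:
  fixes f g :: "real ^ 'd \<Rightarrow> complex"
  assumes Q: "closure Q = orthant"
    and cont: "continuous_on orthant f" "continuous_on orthant g"
    and eq: "\<And>t. t \<in> Q \<Longrightarrow> f t = g t" and t: "t \<in> orthant"
  shows "f t = g t"
proof -
  have "f t - g t = 0"
    by (rule continuous_constant_on_closure[of Q "\<lambda>t. f t - g t"])
      (use assms in \<open>auto intro!: continuous_intros\<close>)
  then show ?thesis by simp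
qed

text \<open>
Multiplication is separately weakly continuous, and this suffices to extend the law in one variable at a
time. In the left factor this is immediate; in the right factor it is where the adjoint enters.
\<close>

lemma semigroup_law_of_dense:
  fixes T :: "real ^ 'd \<Rightarrow> ('h::complex_hilbert_space \<Rightarrow>\<^sub>L 'h)"
  assumes T: "T \<in> contraction_families" and Q: "closure Q = orthant"
    and law: "\<And>s t. s \<in> Q \<Longrightarrow> t \<in> Q \<Longrightarrow> T (s + t) = T s o\<^sub>L T t"
    and s: "s \<in> orthant" and t: "t \<in> orthant"
  shows "T (s + t) = T s o\<^sub>L T t"
proof -
  have Q_sub: "r \<in> orthant" if "r \<in> Q" for r
    using that Q closure_subset by blast
  have cont: "continuous_on orthant (\<lambda>t. cinner (T t x) y)" for x y
    by (rule continuous_on_contraction_families[OF T])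
  have cont_add: "continuous_on orthant (\<lambda>r. cinner (T (u + r) x) y)" if "u \<in> orthant" for u x y
    by (rule continuous_on_compose2[OF cont]) (use that in \<open>auto intro!: continuous_intros add_in_orthant\<close>)
  have law1: "T (r + q) = T r o\<^sub>L T q" if r: "r \<in> orthant" and q: "q \<in> Q" for r q
  proof (intro blinfun_eqI cinner_ext)
    fix x y
    show "cinner (T (r + q) x) y = cinner ((T r o\<^sub>L T q) x) y"
    proof (rule continuous_on_orthant_eq[OF Q _ _ _ r])
      show "continuous_on orthant (\<lambda>r. cinner (T (r + q) x) y)"
        using cont_add[OF Q_sub[OF q]] by (simp add: add.commute)
      show "continuous_on orthant (\<lambda>r. cinner ((T r o\<^sub>L T q) x) y)"
        using cont[of "T q x" y] by simp
    qed (simp add: law q)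
  qed
  show ?thesis
  proof (intro blinfun_eqI cinner_ext)
    fix x y
    obtain v where v: "\<And>x. cinner (T s x) y = cinner x v"
      using adjoint_vector[of "T s" y] contraction_familiesD(1)[OF T s] by blast
    show "cinner (T (s + t) x) y = cinner ((T s o\<^sub>L T t) x) y"
    proof (rule continuous_on_orthant_eq[OF Q cont_add[OF s] _ _ t])
      show "continuous_on orthant (\<lambda>t. cinner ((T s o\<^sub>L T t) x) y)"
        using cont[of x v] by (simp add: v)
    qed (simp add: law1 s)
  qed
qed

lemma countable_dense_in_orthant:
  obtains Q :: "(real ^ 'd) set" where "countable Q" "closure Q = orthant"
proof -
  obtain Q :: "(real ^ 'd) set" where Q: "countable Q" "Q \<subseteq> orthant" "orthant \<subseteq> closure Q"
    by (rule separable)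
  then have "closure Q = orthant"
    using closed_orthant closure_minimal by blast
  then show thesis using that Q by blast
qed

text \<open>
The semigroups are cut out of the closed set of contraction families by \<open>T 0 = id_blinfun\<close>, which is a
closed condition, and by the semigroup law. For times in a countable dense set and vectors in the
sequence \<open>w\<close>, the law says that the coefficient of \<open>T (s + t)\<close> equals the limit of the partial sums of
the product expansion, which is a \<open>G\<^sub>\<delta>\<close> condition.
\<close>

theorem gdelta_weighted_coefficients:
  fixes w :: "nat \<Rightarrow> 'h::complex_hilbert_space"
  assumes dense: "closure (range w) = UNIV"
    and expansion: "\<And>x. (\<lambda>N. partial_expansion (w \<circ> k) N x) \<longlonglongrightarrow> x"
  shows "gdelta_in euclidean
    (weighted_coefficients w ` (contractive_semigroups :: (real ^ 'd \<Rightarrow> ('h \<Rightarrow>\<^sub>L 'h)) set))"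
proof -
  let ?A = "contraction_families :: (real ^ 'd \<Rightarrow> ('h \<Rightarrow>\<^sub>L 'h)) set"
  obtain Q :: "(real ^ 'd) set" where Q: "countable Q" "closure Q = orthant"
    by (rule countable_dense_in_orthant)
  then have Q_sub: "s \<in> orthant" if "s \<in> Q" for s
    using that closure_subset by blast
  define val where "val f m n t = (1 + norm t) *\<^sub>R apply_bcontfun (f (m, n)) t"
    for f :: "nat \<times> nat \<Rightarrow> (real ^ 'd) \<Rightarrow>\<^sub>C complex" and m n t
  have val: "val (weighted_coefficients w T) m n t = cinner (T t (w m)) (w n)"
    if "T \<in> ?A" "t \<in> orthant" for T m n t
    using that by (simp add: val_def coefficient_eq_weighted)
  have cont_val: "continuous_on UNIV (\<lambda>f. val f m n t)" for m n t
    unfolding val_def by (intro continuous_intros continuous_on_apply_bcontfun_coordinate)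
  define I where "I = (\<Inter>m. \<Inter>n. {f. val f m n 0 = cinner (w m) (w n)})"
  define P where "P f s t m n N = (\<Sum>i<N. val f m (k i) t * val f (k i) n s)" for f s t m n N
  define W where "W = (\<lambda>(s, t, m, n, j, M). \<Union>N\<in>{M..}.
      {f. dist (P f s t m n N) (val f m n (s + t)) < inverse (real (Suc j))})"
  define J where "J = Q \<times> Q \<times> (UNIV :: (nat \<times> nat \<times> nat \<times> nat) set)"
  have "closed I"
    unfolding I_def
    by (intro closed_INT ballI closed_Collect_eq cont_val continuous_on_const)
  have "open (W c)" for c
  proof -
    obtain s t m n j M where c: "c = (s, t, m, n, j, M)" by (metis prod_cases6)
    show ?thesis
      unfolding c W_def P_def
      by (auto intro!: open_Collect_less continuous_intros cont_val)
  qed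
  have "weighted_coefficients w T \<in> I \<longleftrightarrow> T 0 = id_blinfun" if T: "T \<in> ?A" for T
  proof -
    have "weighted_coefficients w T \<in> I \<longleftrightarrow>
        (\<forall>m n. cinner (T 0 (w m)) (w n) = cinner (blinfun_apply id_blinfun (w m)) (w n))"
      by (simp add: I_def val[OF T])
    then show ?thesis
      using blinfun_eq_of_dense_coefficients[OF dense] by metis
  qed
  moreover have "weighted_coefficients w T \<in> (\<Inter>c\<in>J. W c) \<longleftrightarrow>
      (\<forall>s\<in>orthant. \<forall>t\<in>orthant. T (s + t) = T s o\<^sub>L T t)" if T: "T \<in> ?A" for T
  proof -
    have limP: "(\<lambda>N. P (weighted_coefficients w T) s t m n N) \<longlonglongrightarrow> cinner ((T s o\<^sub>L T t) (w m)) (w n)"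
      if "s \<in> orthant" "t \<in> orthant" for s t m n
      using tendsto_product_coefficient[OF contraction_familiesD(1)[OF T that(1)] expansion,
          of "T t (w m)" "w n"] that
      by (simp add: P_def val[OF T])
    have law_iff: "cinner ((T s o\<^sub>L T t) (w m)) (w n) = cinner (T (s + t) (w m)) (w n) \<longleftrightarrow>
        (\<forall>j M. weighted_coefficients w T \<in> W (s, t, m, n, j, M))"
      if "s \<in> orthant" "t \<in> orthant" for s t m n
      unfolding LIMSEQ_eq_iff_frequently_close[OF limP[OF that]]
      by (simp add: W_def Bex_def val[OF T] add_in_orthant that)
    have "weighted_coefficients w T \<in> (\<Inter>c\<in>J. W c) \<longleftrightarrow>
        (\<forall>s\<in>Q. \<forall>t\<in>Q. \<forall>m n j M. weighted_coefficients w T \<in> W (s, t, m, n, j, M))"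
      by (auto simp: J_def)
    also have "\<dots> \<longleftrightarrow> (\<forall>s\<in>Q. \<forall>t\<in>Q. \<forall>m n.
        cinner (T (s + t) (w m)) (w n) = cinner ((T s o\<^sub>L T t) (w m)) (w n))"
      using law_iff Q_sub by metis
    also have "\<dots> \<longleftrightarrow> (\<forall>s\<in>Q. \<forall>t\<in>Q. T (s + t) = T s o\<^sub>L T t)"
      using blinfun_eq_of_dense_coefficients[OF dense] by metis
    also have "\<dots> \<longleftrightarrow> (\<forall>s\<in>orthant. \<forall>t\<in>orthant. T (s + t) = T s o\<^sub>L T t)"
      using semigroup_law_of_dense[OF T Q(2)] Q_sub by blast
    finally show ?thesis .
  qed
  ultimately have "weighted_coefficients w ` contractive_semigroups =
      (weighted_coefficients w ` ?A \<inter> I) \<inter> (\<Inter>c\<in>J. W c)"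
    unfolding contractive_semigroups_eq by (auto simp del: INT_iff)
  moreover have "gdelta_in euclidean (weighted_coefficients w ` ?A \<inter> I)"
    by (intro closed_imp_gdelta_in metrizable_space_euclidean)
      (simp only: closed_closedin[symmetric] closed_Int closed_weighted_coefficients[OF dense] \<open>closed I\<close>)
  moreover have "gdelta_in euclidean (\<Inter>c\<in>J. W c)"
  proof (rule gdelta_in_Inter)
    show "countable (W ` J)"
      unfolding J_def using Q(1) by (intro countable_image countable_SIGMA) auto
    have "Q \<noteq> {}"
      using Q(2) zero_in_orthant by (metis closure_empty empty_iff)
    then show "W ` J \<noteq> {}" by (auto simp: J_def)
  qed (use \<open>\<And>c. open (W c)\<close> in \<open>auto intro!: open_imp_gdelta_in\<close>)
  ultimately show ?thesis
    by (simp only: gdelta_in_Int)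
qed

section \<open>Separability\<close>

text \<open>
The members of a network need not be open, so a network is easier to exhibit than a base; it is still
enough to choose one point from each member.
\<close>

lemma separable_space_of_countable_network:
  assumes "countable \<N>"
    and network: "\<And>U x. openin X U \<Longrightarrow> x \<in> U \<Longrightarrow> \<exists>N\<in>\<N>. x \<in> N \<and> N \<subseteq> U"
  shows "separable_space X"
proof -
  define pick where "pick N = (SOME x. x \<in> N \<inter> topspace X)" for N
  have pick: "pick N \<in> N \<inter> topspace X" if "N \<inter> topspace X \<noteq> {}" for N
    unfolding pick_def using that some_in_eq by blast
  define C where "C = pick ` {N \<in> \<N>. N \<inter> topspace X \<noteq> {}}"
  have "\<exists>y\<in>C. y \<in> U" if U: "openin X U" "x \<in> U" for x U
  proof -
    obtain N where N: "N \<in> \<N>" "x \<in> N" "N \<subseteq> U" using network[OF U] by blast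
    moreover have "x \<in> topspace X" using U openin_subset by blast
    ultimately have "pick N \<in> C" "pick N \<in> U" using pick by (auto simp: C_def)
    then show ?thesis by blast
  qed
  then have "topspace X \<subseteq> X closure_of C"
    unfolding in_closure_of subset_iff by blast
  moreover have "countable C" "C \<subseteq> topspace X"
    using assms(1) pick by (auto simp: C_def)
  ultimately show ?thesis
    unfolding separable_space_def using closure_of_subset_topspace by fast
qed

text \<open>
The network consists of the sets of semigroups that obey finitely many conditions "on this ball of times,
this coefficient stays within this distance of this number", with all parameters taken from countable
sets. By compactness and continuity, finitely many such conditions hold for \<open>T\<close> and pin down a given
coefficient on a given compact set up to a prescribed error.
\<close>

theorem separable_semigroup_topology:
  fixes w :: "nat \<Rightarrow> 'h::complex_inner"
  assumes dense: "closure (range w) = UNIV"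
  shows "separable_space (semigroup_topology :: (real ^ 'd \<Rightarrow> ('h \<Rightarrow>\<^sub>L 'h)) topology)"
proof -
  let ?C = "contractive_semigroups :: (real ^ 'd \<Rightarrow> ('h \<Rightarrow>\<^sub>L 'h)) set"
  obtain D :: "(real ^ 'd) set" where D: "countable D" "\<And>U. open U \<Longrightarrow> U \<noteq> {} \<Longrightarrow> \<exists>d\<in>D. d \<in> U"
    using countable_dense_exists by blast
  obtain E :: "complex set" where E: "countable E" "\<And>U. open U \<Longrightarrow> U \<noteq> {} \<Longrightarrow> \<exists>d\<in>E. d \<in> U"
    using countable_dense_exists by blast
  define rad where "rad j = inverse (real (Suc j))" for j
  define sat where "sat T = (\<lambda>(m, n, q, i, b, j). \<forall>t\<in>orthant \<inter> ball q (rad i).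
      cmod (cinner (blinfun_apply (T t) (w m)) (w n) - b) < rad j)" for T :: "real ^ 'd \<Rightarrow> ('h \<Rightarrow>\<^sub>L 'h)"
  define Cond where "Cond = (UNIV :: nat set) \<times> (UNIV :: nat set) \<times> D \<times> (UNIV :: nat set) \<times> E \<times> (UNIV :: nat set)"
  have "countable Cond"
    unfolding Cond_def using D(1) E(1) by (intro countable_SIGMA) auto
  define N where "N F = {T \<in> ?C. \<forall>c\<in>F. sat T c}" for F
  have rad_pos: "0 < rad j" for j by (simp add: rad_def)
  have rad_small: "\<exists>j. rad j < e" if "0 < e" for e
    using reals_Archimedean[OF that] by (auto simp: rad_def)
  have "\<exists>V\<in>N ` {F. finite F \<and> F \<subseteq> Cond}. T \<in> V \<and> V \<subseteq> U"
    if U: "openin semigroup_topology U" and TU: "T \<in> U" for U T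
  proof -
    have T: "T \<in> ?C"
      using U TU openin_subset topspace_semigroup_topology by blast
    define \<F> where "\<F> = {F. finite F \<and> F \<subseteq> Cond \<and> (\<forall>c\<in>F. sat T c)}"
    \<comment> \<open>The filter generated by the network sets around \<open>T\<close>; the claim is that it converges to \<open>T\<close>.\<close>
    define G where "G = (INF F\<in>\<F>. principal (N F))"
    have ev: "eventually P G \<longleftrightarrow> (\<exists>F\<in>\<F>. \<forall>S\<in>N F. P S)" for P
      unfolding G_def
    proof (subst eventually_INF_base)
      show "\<F> \<noteq> {}" by (auto simp: \<F>_def)
      show "\<exists>H\<in>\<F>. principal (N H) \<le> inf (principal (N F)) (principal (N F'))"
        if "F \<in> \<F>" "F' \<in> \<F>" for F F'
        using that by (intro bexI[of _ "F \<union> F'"]) (auto simp: \<F>_def N_def)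
    qed (simp add: eventually_principal)
    have in_C: "\<forall>\<^sub>F S in G. S \<in> ?C"
      unfolding ev by (intro bexI[of _ "{}"]) (auto simp: \<F>_def N_def)
    have "limitin semigroup_topology (\<lambda>S. S) T G"
    proof (rule limitin_semigroup_topology_of_dense[OF dense T in_C])
      fix m n and K :: "(real ^ 'd) set"
      assume K: "compact K" "K \<subseteq> orthant" "K \<noteq> {}"
      show "((\<lambda>S. weak_dist K (w m) (w n) S T) \<longlongrightarrow> 0) G"
      proof (rule tendstoI)
        fix e :: real assume e: "0 < e"
        then obtain j where j: "rad j < e / 3" using rad_small[of "e / 3"] by auto
        let ?g = "\<lambda>t. cinner (T t (w m)) (w n)"
        have cond_ex: "\<exists>q\<in>D. \<exists>i. \<exists>b\<in>E. t \<in> ball q (rad i) \<and> sat T (m, n, q, i, b, j)" if t: "t \<in> K" for t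
        proof -
          obtain b where b: "b \<in> E" "dist (?g t) b < rad j / 2"
            using E(2)[of "ball (?g t) (rad j / 2)"] rad_pos[of j] by auto
          have "0 < rad j / 2" using rad_pos[of j] by simp
          have "continuous_on orthant ?g"
            using T contractive_semigroups_subset by (intro continuous_on_contraction_families) auto
          then obtain d where d: "0 < d" "\<And>s. s \<in> orthant \<Longrightarrow> dist s t < d \<Longrightarrow> dist (?g s) (?g t) < rad j / 2"
            unfolding continuous_on_iff using subsetD[OF K(2) t] \<open>0 < rad j / 2\<close> by blast
          obtain i where i: "rad i < d / 2" using rad_small[of "d / 2"] d(1) by auto
          obtain q where q: "q \<in> D" "dist t q < rad i"
            using D(2)[of "ball t (rad i)"] rad_pos[of i] by auto
          have "cmod (?g s - b) < rad j" if s: "s \<in> orthant" "dist q s < rad i" for s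
          proof -
            have "dist s t < d"
              using dist_triangle[of s t q] s(2) q(2) i by (simp add: dist_commute)
            then have "dist (?g s) b < rad j"
              using d(2)[OF s(1)] b(2) dist_triangle[of "?g s" b "?g t"] by linarith
            then show ?thesis by (simp add: dist_norm)
          qed
          then have "sat T (m, n, q, i, b, j)"
            by (simp add: sat_def)
          moreover have "t \<in> ball q (rad i)"
            using q(2) by (simp add: dist_commute)
          ultimately show ?thesis
            using q(1) b(1) by blast
        qed
        define H where "H = {(m', n', q, i, b, j') \<in> Cond. m' = m \<and> n' = n \<and> j' = j \<and> sat T (m, n, q, i, b, j)}"
        define B where "B = (\<lambda>(m'::nat, n'::nat, q::real ^ 'd, i, b::complex, j'::nat). ball q (rad i))"
        have cover: "K \<subseteq> (\<Union>c\<in>H. B c)"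
        proof
          fix t assume "t \<in> K"
          then obtain q i b where "q \<in> D" "b \<in> E" "t \<in> ball q (rad i)" "sat T (m, n, q, i, b, j)"
            using cond_ex by blast
          then show "t \<in> (\<Union>c\<in>H. B c)"
            by (intro UN_I[of "(m, n, q, i, b, j)"]) (auto simp: H_def B_def Cond_def)
        qed
        have open_B: "open (B c)" for c by (auto simp: B_def split: prod.split)
        obtain F where F: "F \<subseteq> H" "finite F" "K \<subseteq> (\<Union>c\<in>F. B c)"
          by (rule compactE_image[OF K(1) open_B cover])
        have "F \<in> \<F>" using F(1,2) by (auto simp: \<F>_def H_def)
        moreover have "dist (weak_dist K (w m) (w n) S T) 0 < e" if S: "S \<in> N F" for S
        proof -
          have SC: "S \<in> ?C" using S by (simp add: N_def)
          have "weak_dist K (w m) (w n) S T \<le> 2 * rad j"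
          proof (rule weak_dist_least[OF K(3)])
            fix t assume t: "t \<in> K"
            then obtain c where cF: "c \<in> F" and tc: "t \<in> B c" using F(3) by blast
            then have "c \<in> H" using F(1) by blast
            then obtain q i b where c: "c = (m, n, q, i, b, j)" and "sat T c"
              unfolding H_def by blast
            moreover have "sat S c"
              using S cF by (simp add: N_def)
            moreover have "t \<in> orthant \<inter> ball q (rad i)"
              using tc t K(2) by (auto simp: B_def c)
            ultimately have "cmod (cinner (S t (w m)) (w n) - b) < rad j" "cmod (?g t - b) < rad j"
              unfolding sat_def by auto
            then have "cmod (cinner (S t (w m)) (w n) - ?g t) \<le> 2 * rad j"
              using norm_triangle_ineq4[of "cinner (S t (w m)) (w n) - b" "?g t - b"] by simp
            then show "cmod (cinner ((S t - T t) (w m)) (w n)) \<le> 2 * rad j"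
              by (simp add: blinfun.diff_left cinner.diff_left)
          qed
          then show ?thesis
            using weak_dist_nonneg[OF SC T K(2,3), of "w m" "w n"] j e by simp
        qed
        ultimately show "\<forall>\<^sub>F S in G. dist (weak_dist K (w m) (w n) S T) 0 < e"
          unfolding ev by blast
      qed
    qed
    then have "\<forall>\<^sub>F S in G. S \<in> U"
      using U TU by (auto simp: limitin_def)
    then obtain F where "F \<in> \<F>" "N F \<subseteq> U"
      unfolding ev by blast
    moreover from this have "T \<in> N F" using T by (simp add: \<F>_def N_def)
    ultimately show ?thesis by (auto simp: \<F>_def)
  qed
  moreover have "countable (N ` {F. finite F \<and> F \<subseteq> Cond})"
    using \<open>countable Cond\<close> by (intro countable_image countable_Collect_finite_subset)
  ultimately show ?thesis
    by (rule separable_space_of_countable_network[rotated])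
qed

section \<open>Polishness\<close>

theorem corollary4p3:
  assumes "separable_space (euclidean :: 'h::complex_hilbert_space topology)"
  shows "Polish_topology
           (semigroup_topology :: (real ^ 'd \<Rightarrow> ('h \<Rightarrow>\<^sub>L 'h)) topology)"
proof -
  obtain w :: "nat \<Rightarrow> 'h" and k where
    dense: "closure (range w) = UNIV"
    and expansion: "\<And>x. (\<lambda>N. partial_expansion (w \<circ> k) N x) \<longlonglongrightarrow> x"
    using dense_sequence_with_expansion[OF assms] by blast
  have "completely_metrizable_space (semigroup_topology :: (real ^ 'd \<Rightarrow> ('h \<Rightarrow>\<^sub>L 'h)) topology)"
    using homeomorphic_completely_metrizable_space[OF homeomorphic_weighted_coefficients[OF dense]]
      completely_metrizable_space_gdelta_in[OF completely_metrizable_space_euclidean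
        gdelta_weighted_coefficients[OF dense expansion]]
    by blast
  then show ?thesis
    unfolding Polish_topology_def using separable_semigroup_topology[OF dense] by blast
qed

end
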